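(* $\mathsf{RCA}_0 \vdash \mathsf{SEM} \rightarrow \mathsf{SRRT}^2_2$.
   Context: $\mathsf{RCA}_0$ is the usual base system of reverse mathematics (second-order arithmetic with $\Delta^0_1$-comprehension and $\Sigma^0_1$-induction). A tournament $T$ on a domain $D\subseteq\mathbb{N}$ is an irreflexive binary relation on $D$ such that for all $x\ne y$ in $D$ exactly one of $T(x,y)$, $T(y,x)$ holds. It is transitive if the relation is transitive. It is stable if for every $x\in D$, either $T(x,s)$ holds for all but finitely many $s\in D$ or $T(s,x)$ holds for all but finitely many $s\in D$. $\mathsf{SEM}$ is the statement "every infinite stable tournament has an infinite transitive subtournament". $f:[\mathbb{N}]^2\to\mathbb{N}$ (defined on pairs $x<s$) is 2-bounded if $|f^{-1}(y)|\le2$ for every $y$. It is rainbow-stable if for every $x$ one of the following holds: (a) there is $y\neq x$ with $f(x,s)=f(y,s)$ for all but finitely many $s$; or (b) for all but finitely many $s$ there is no $y\ne x$ with $f(x,s)=f(y,s)$. A set $R$ is a rainbow for $f$ if $f$ is injective on $[R]^2$. $\mathsf{SRRT}^2_2$ is the statement "every rainbow-stable 2-bounded coloring $f:[\mathbb{N}]^2\to\mathbb{N}$ has an infinite rainbow". *)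

theory Defs
  imports Main
begin

section \<open>The language of second-order arithmetic\<close>

text \<open>
  Variables are de Bruijn indices, with separate index spaces for number variables and set
  variables: a number quantifier does not shift set indices, and vice versa. The only set terms
  are set variables, and (as usual) equality is primitive for numbers only.
\<close>

datatype tm =
    Var nat
  | Zero
  | One
  | Add tm tm (infixl "\<^bold>+" 85)
  | Mul tm tm (infixl "\<^bold>*" 87)

datatype form =
    Bot
  | Eq tm tm (infix "\<^bold>=" 80)
  | Less tm tm (infix "\<^bold><" 80)
  | Mem tm nat (infix "\<^bold>\<in>" 80)
  | Imp form form (infixr "\<^bold>\<longrightarrow>" 55)
  | NAll form
  | SAll form

abbreviation Neg :: "form \<Rightarrow> form" ("\<^bold>\<not> _" [75] 75) where
  "\<^bold>\<not> p \<equiv> p \<^bold>\<longrightarrow> Bot"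

abbreviation Con :: "form \<Rightarrow> form \<Rightarrow> form" (infixr "\<^bold>\<and>" 70) where
  "p \<^bold>\<and> q \<equiv> \<^bold>\<not> (p \<^bold>\<longrightarrow> \<^bold>\<not> q)"

abbreviation Dis :: "form \<Rightarrow> form \<Rightarrow> form" (infixr "\<^bold>\<or>" 65) where
  "p \<^bold>\<or> q \<equiv> \<^bold>\<not> p \<^bold>\<longrightarrow> q"

abbreviation Iff :: "form \<Rightarrow> form \<Rightarrow> form" (infix "\<^bold>\<longleftrightarrow>" 50) where
  "p \<^bold>\<longleftrightarrow> q \<equiv> (p \<^bold>\<longrightarrow> q) \<^bold>\<and> (q \<^bold>\<longrightarrow> p)"

abbreviation NEx :: "form \<Rightarrow> form" where
  "NEx p \<equiv> \<^bold>\<not> NAll (\<^bold>\<not> p)"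

abbreviation SEx :: "form \<Rightarrow> form" where
  "SEx p \<equiv> \<^bold>\<not> SAll (\<^bold>\<not> p)"


subsection \<open>Simultaneous substitution\<close>

primrec tsubst :: "(nat \<Rightarrow> tm) \<Rightarrow> tm \<Rightarrow> tm" where
  "tsubst \<sigma> (Var i) = \<sigma> i"
| "tsubst \<sigma> Zero = Zero"
| "tsubst \<sigma> One = One"
| "tsubst \<sigma> (s \<^bold>+ t) = tsubst \<sigma> s \<^bold>+ tsubst \<sigma> t"
| "tsubst \<sigma> (s \<^bold>* t) = tsubst \<sigma> s \<^bold>* tsubst \<sigma> t"

definition tlift :: "tm \<Rightarrow> tm" where
  "tlift = tsubst (\<lambda>i. Var (Suc i))"

primrec fsubst :: "(nat \<Rightarrow> tm) \<Rightarrow> (nat \<Rightarrow> nat) \<Rightarrow> form \<Rightarrow> form" where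
  "fsubst \<sigma> \<rho> Bot = Bot"
| "fsubst \<sigma> \<rho> (s \<^bold>= t) = (tsubst \<sigma> s \<^bold>= tsubst \<sigma> t)"
| "fsubst \<sigma> \<rho> (s \<^bold>< t) = (tsubst \<sigma> s \<^bold>< tsubst \<sigma> t)"
| "fsubst \<sigma> \<rho> (t \<^bold>\<in> X) = (tsubst \<sigma> t \<^bold>\<in> \<rho> X)"
| "fsubst \<sigma> \<rho> (p \<^bold>\<longrightarrow> q) = (fsubst \<sigma> \<rho> p \<^bold>\<longrightarrow> fsubst \<sigma> \<rho> q)"
| "fsubst \<sigma> \<rho> (NAll p) = NAll (fsubst (case_nat (Var 0) (tlift \<circ> \<sigma>)) \<rho> p)"
| "fsubst \<sigma> \<rho> (SAll p) = SAll (fsubst \<sigma> (case_nat 0 (Suc \<circ> \<rho>)) p)"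

definition nlift :: "form \<Rightarrow> form" where
  "nlift = fsubst (\<lambda>i. Var (Suc i)) id"

definition slift :: "form \<Rightarrow> form" where
  "slift = fsubst Var Suc"

definition ninst :: "tm \<Rightarrow> form \<Rightarrow> form" where
  "ninst t = fsubst (case_nat t Var) id"

definition sinst :: "nat \<Rightarrow> form \<Rightarrow> form" where
  "sinst X = fsubst Var (case_nat X id)"


subsection \<open>Sentences\<close>

primrec tclosed :: "nat \<Rightarrow> tm \<Rightarrow> bool" where
  "tclosed n (Var i) \<longleftrightarrow> i < n"
| "tclosed n Zero \<longleftrightarrow> True"
| "tclosed n One \<longleftrightarrow> True"
| "tclosed n (s \<^bold>+ t) \<longleftrightarrow> tclosed n s \<and> tclosed n t"
| "tclosed n (s \<^bold>* t) \<longleftrightarrow> tclosed n s \<and> tclosed n t"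

text \<open>All free number indices are below \<open>n\<close> and all free set indices are below \<open>m\<close>.\<close>

primrec fclosed :: "nat \<Rightarrow> nat \<Rightarrow> form \<Rightarrow> bool" where
  "fclosed n m Bot \<longleftrightarrow> True"
| "fclosed n m (s \<^bold>= t) \<longleftrightarrow> tclosed n s \<and> tclosed n t"
| "fclosed n m (s \<^bold>< t) \<longleftrightarrow> tclosed n s \<and> tclosed n t"
| "fclosed n m (t \<^bold>\<in> X) \<longleftrightarrow> tclosed n t \<and> X < m"
| "fclosed n m (p \<^bold>\<longrightarrow> q) \<longleftrightarrow> fclosed n m p \<and> fclosed n m q"
| "fclosed n m (NAll p) \<longleftrightarrow> fclosed (Suc n) m p"
| "fclosed n m (SAll p) \<longleftrightarrow> fclosed n (Suc m) p"

definition sentence :: "form \<Rightarrow> bool" where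
  "sentence p \<longleftrightarrow> fclosed 0 0 p"

definition universal_closures :: "form set \<Rightarrow> form set" where
  "universal_closures A =
    {q. sentence q \<and> (\<exists>p\<in>A. \<exists>n m. q = (SAll ^^ m) ((NAll ^^ n) p))}"


section \<open>Provability: classical two-sorted natural deduction with equality\<close>

inductive proves :: "form set \<Rightarrow> form \<Rightarrow> bool" (infix "\<turnstile>" 45) where
  Assm: "p \<in> \<Gamma> \<Longrightarrow> \<Gamma> \<turnstile> p"
| ImpI: "insert p \<Gamma> \<turnstile> q \<Longrightarrow> \<Gamma> \<turnstile> p \<^bold>\<longrightarrow> q"
| ImpE: "\<Gamma> \<turnstile> p \<^bold>\<longrightarrow> q \<Longrightarrow> \<Gamma> \<turnstile> p \<Longrightarrow> \<Gamma> \<turnstile> q"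
| Contr: "insert (\<^bold>\<not> p) \<Gamma> \<turnstile> Bot \<Longrightarrow> \<Gamma> \<turnstile> p"
| NAllI: "nlift ` \<Gamma> \<turnstile> p \<Longrightarrow> \<Gamma> \<turnstile> NAll p"
| NAllE: "\<Gamma> \<turnstile> NAll p \<Longrightarrow> \<Gamma> \<turnstile> ninst t p"
| SAllI: "slift ` \<Gamma> \<turnstile> p \<Longrightarrow> \<Gamma> \<turnstile> SAll p"
| SAllE: "\<Gamma> \<turnstile> SAll p \<Longrightarrow> \<Gamma> \<turnstile> sinst X p"
| EqRefl: "\<Gamma> \<turnstile> t \<^bold>= t"
| EqSubst: "\<Gamma> \<turnstile> s \<^bold>= t \<Longrightarrow> \<Gamma> \<turnstile> ninst s p \<Longrightarrow> \<Gamma> \<turnstile> ninst t p"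


section \<open>The system \<open>RCA\<^sub>0\<close>\<close>

text \<open>
  Lifting the bound \<open>t\<close> enforces that the quantified variable does not occur in it. Bounded
  existential quantification is covered by duality.
\<close>

inductive Delta00 :: "form \<Rightarrow> bool" where
  "Delta00 Bot"
| "Delta00 (s \<^bold>= t)"
| "Delta00 (s \<^bold>< t)"
| "Delta00 (t \<^bold>\<in> X)"
| "Delta00 p \<Longrightarrow> Delta00 q \<Longrightarrow> Delta00 (p \<^bold>\<longrightarrow> q)"
| "Delta00 p \<Longrightarrow> Delta00 (NAll (Var 0 \<^bold>< tlift t \<^bold>\<longrightarrow> p))"

definition Sigma01 :: "form \<Rightarrow> bool" where
  "Sigma01 p \<longleftrightarrow> (\<exists>q. Delta00 q \<and> p = NEx q)"

definition Pi01 :: "form \<Rightarrow> bool" where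
  "Pi01 p \<longleftrightarrow> (\<exists>q. Delta00 q \<and> p = NAll q)"

definition basic_axioms :: "form set" where
  "basic_axioms =
    { \<^bold>\<not> (Var 0 \<^bold>+ One \<^bold>= Zero),
      Var 1 \<^bold>+ One \<^bold>= Var 0 \<^bold>+ One \<^bold>\<longrightarrow> Var 1 \<^bold>= Var 0,
      Var 0 \<^bold>+ Zero \<^bold>= Var 0,
      Var 1 \<^bold>+ (Var 0 \<^bold>+ One) \<^bold>= (Var 1 \<^bold>+ Var 0) \<^bold>+ One,
      Var 0 \<^bold>* Zero \<^bold>= Zero,
      Var 1 \<^bold>* (Var 0 \<^bold>+ One) \<^bold>= Var 1 \<^bold>* Var 0 \<^bold>+ Var 1,
      \<^bold>\<not> (Var 0 \<^bold>< Zero),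
      Var 1 \<^bold>< Var 0 \<^bold>+ One \<^bold>\<longleftrightarrow> Var 1 \<^bold>< Var 0 \<^bold>\<or> Var 1 \<^bold>= Var 0 }"

text \<open>
  In the two schemes the distinguished number variable of \<open>p\<close> (and \<open>q\<close>) is index \<open>0\<close>; all other
  free number and set variables are parameters.
\<close>

definition succ_inst :: "form \<Rightarrow> form" where
  "succ_inst = fsubst (case_nat (Var 0 \<^bold>+ One) (\<lambda>i. Var (Suc i))) id"

definition induction_axiom :: "form \<Rightarrow> form" where
  "induction_axiom p = (ninst Zero p \<^bold>\<and> NAll (p \<^bold>\<longrightarrow> succ_inst p) \<^bold>\<longrightarrow> NAll p)"

definition comprehension_axiom :: "form \<Rightarrow> form \<Rightarrow> form" where
  "comprehension_axiom p q =
    (NAll (p \<^bold>\<longleftrightarrow> q) \<^bold>\<longrightarrow> SEx (NAll (Var 0 \<^bold>\<in> 0 \<^bold>\<longleftrightarrow> slift p)))"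

definition RCA0 :: "form set" where
  "RCA0 = universal_closures
    (basic_axioms \<union>
     {induction_axiom p | p. Sigma01 p} \<union>
     {comprehension_axiom p q | p q. Sigma01 p \<and> Pi01 q})"


section \<open>The two principles\<close>

text \<open>
  The usual pairing term \<open>(x, y) \<mapsto> (x + y)\<^sup>2 + x\<close>, which \<open>RCA\<^sub>0\<close> proves injective. In this section
  the arguments \<open>D\<close>, \<open>T\<close>, \<open>F\<close>, \<open>R\<close>, \<dots> are indices of set variables. ``All but finitely many'' is
  rendered as ``all beyond some bound'', and ``infinite'' as ``unbounded''.
\<close>

definition pair :: "tm \<Rightarrow> tm \<Rightarrow> tm" where
  "pair s t = (s \<^bold>+ t) \<^bold>* (s \<^bold>+ t) \<^bold>+ s"

definition infinite_set :: "nat \<Rightarrow> form" where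
  "infinite_set X = NAll (NEx (Var 1 \<^bold>< Var 0 \<^bold>\<and> Var 0 \<^bold>\<in> X))"

definition subset_of :: "nat \<Rightarrow> nat \<Rightarrow> form" where
  "subset_of X Y = NAll (Var 0 \<^bold>\<in> X \<^bold>\<longrightarrow> Var 0 \<^bold>\<in> Y)"


subsection \<open>Tournaments\<close>

definition rel :: "nat \<Rightarrow> tm \<Rightarrow> tm \<Rightarrow> form" where
  "rel T s t = (pair s t \<^bold>\<in> T)"

definition tournament :: "nat \<Rightarrow> nat \<Rightarrow> form" where
  "tournament D T =
    (NAll (Var 0 \<^bold>\<in> T \<^bold>\<longrightarrow>
       NEx (NEx (Var 1 \<^bold>\<in> D \<^bold>\<and> Var 0 \<^bold>\<in> D \<^bold>\<and> Var 2 \<^bold>= pair (Var 1) (Var 0)))) \<^bold>\<and>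
     NAll (Var 0 \<^bold>\<in> D \<^bold>\<longrightarrow> \<^bold>\<not> rel T (Var 0) (Var 0)) \<^bold>\<and>
     NAll (NAll (Var 1 \<^bold>\<in> D \<^bold>\<and> Var 0 \<^bold>\<in> D \<^bold>\<and> \<^bold>\<not> (Var 1 \<^bold>= Var 0) \<^bold>\<longrightarrow>
       (rel T (Var 1) (Var 0) \<^bold>\<longleftrightarrow> \<^bold>\<not> rel T (Var 0) (Var 1)))))"

definition stable :: "nat \<Rightarrow> nat \<Rightarrow> form" where
  "stable D T =
    NAll (Var 0 \<^bold>\<in> D \<^bold>\<longrightarrow>
      NEx (NAll (Var 0 \<^bold>\<in> D \<^bold>\<and> Var 1 \<^bold>< Var 0 \<^bold>\<longrightarrow> rel T (Var 2) (Var 0))) \<^bold>\<or>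
      NEx (NAll (Var 0 \<^bold>\<in> D \<^bold>\<and> Var 1 \<^bold>< Var 0 \<^bold>\<longrightarrow> rel T (Var 0) (Var 2))))"

definition transitive_on :: "nat \<Rightarrow> nat \<Rightarrow> form" where
  "transitive_on H T =
    NAll (NAll (NAll (Var 2 \<^bold>\<in> H \<^bold>\<and> Var 1 \<^bold>\<in> H \<^bold>\<and> Var 0 \<^bold>\<in> H \<^bold>\<and>
      rel T (Var 2) (Var 1) \<^bold>\<and> rel T (Var 1) (Var 0) \<^bold>\<longrightarrow> rel T (Var 2) (Var 0))))"

text \<open>
  A subtournament is given by its domain \<open>H\<close>. In the premise \<open>D\<close> is set variable \<open>1\<close> and \<open>T\<close> is
  set variable \<open>0\<close>; under the quantifier for \<open>H\<close> these become \<open>2\<close> and \<open>1\<close>.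
\<close>

definition SEM :: form where
  "SEM = SAll (SAll (infinite_set 1 \<^bold>\<and> tournament 1 0 \<^bold>\<and> stable 1 0 \<^bold>\<longrightarrow>
     SEx (infinite_set 0 \<^bold>\<and> subset_of 0 2 \<^bold>\<and> transitive_on 0 1)))"


subsection \<open>Rainbows\<close>

text \<open>
  A coloring is its graph: a set \<open>F\<close> of codes \<open>((x, s), c)\<close> with \<open>x < s\<close>.
\<close>

definition val :: "nat \<Rightarrow> tm \<Rightarrow> tm \<Rightarrow> tm \<Rightarrow> form" where
  "val F x s c = (pair (pair x s) c \<^bold>\<in> F)"

definition coloring :: "nat \<Rightarrow> form" where
  "coloring F =
    (NAll (Var 0 \<^bold>\<in> F \<^bold>\<longrightarrow>
       NEx (NEx (NEx (Var 2 \<^bold>< Var 1 \<^bold>\<and> Var 3 \<^bold>= pair (pair (Var 2) (Var 1)) (Var 0))))) \<^bold>\<and>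
     NAll (NAll (Var 1 \<^bold>< Var 0 \<^bold>\<longrightarrow>
       NEx (val F (Var 2) (Var 1) (Var 0) \<^bold>\<and>
         NAll (val F (Var 3) (Var 2) (Var 0) \<^bold>\<longrightarrow> Var 0 \<^bold>= Var 1)))))"

text \<open>
  Among any three elements of the fiber of a color (index \<open>3\<close>), two coincide; the elements are
  codes of pairs.
\<close>

definition two_bounded :: "nat \<Rightarrow> form" where
  "two_bounded F =
    NAll (NAll (NAll (NAll
      (pair (Var 2) (Var 3) \<^bold>\<in> F \<^bold>\<and> pair (Var 1) (Var 3) \<^bold>\<in> F \<^bold>\<and> pair (Var 0) (Var 3) \<^bold>\<in> F \<^bold>\<longrightarrow>
        Var 2 \<^bold>= Var 1 \<^bold>\<or> Var 2 \<^bold>= Var 0 \<^bold>\<or> Var 1 \<^bold>= Var 0))))"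

text \<open>
  \<open>f(x, s) = f(y, s)\<close>, both sides being defined (so that \<open>x, y < s\<close>).
\<close>

definition same_val :: "nat \<Rightarrow> tm \<Rightarrow> tm \<Rightarrow> tm \<Rightarrow> form" where
  "same_val F x y s =
    NEx (val F (tlift x) (tlift s) (Var 0) \<^bold>\<and> val F (tlift y) (tlift s) (Var 0))"

text \<open>
  In the first alternative the indices are \<open>x = 3\<close>, \<open>y = 2\<close>, bound \<open>1\<close>, \<open>s = 0\<close>; in the second
  \<open>x = 3\<close>, bound \<open>2\<close>, \<open>s = 1\<close>, \<open>y = 0\<close>.
\<close>

definition rainbow_stable :: "nat \<Rightarrow> form" where
  "rainbow_stable F =
    NAll
     (NEx (\<^bold>\<not> (Var 0 \<^bold>= Var 1) \<^bold>\<and>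
        NEx (NAll (Var 1 \<^bold>< Var 0 \<^bold>\<longrightarrow> same_val F (Var 3) (Var 2) (Var 0)))) \<^bold>\<or>
      NEx (NAll (Var 1 \<^bold>< Var 0 \<^bold>\<longrightarrow>
        \<^bold>\<not> NEx (\<^bold>\<not> (Var 0 \<^bold>= Var 3) \<^bold>\<and> same_val F (Var 3) (Var 0) (Var 1)))))"

text \<open>
  Injectivity on \<open>[R]\<^sup>2\<close>: the pairs are \<open>(4, 3)\<close> and \<open>(2, 1)\<close>, the common color is \<open>0\<close>.
\<close>

definition rainbow :: "nat \<Rightarrow> nat \<Rightarrow> form" where
  "rainbow R F =
    NAll (NAll (NAll (NAll (NAll
      (Var 4 \<^bold>\<in> R \<^bold>\<and> Var 3 \<^bold>\<in> R \<^bold>\<and> Var 2 \<^bold>\<in> R \<^bold>\<and> Var 1 \<^bold>\<in> R \<^bold>\<and>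
       Var 4 \<^bold>< Var 3 \<^bold>\<and> Var 2 \<^bold>< Var 1 \<^bold>\<and>
       val F (Var 4) (Var 3) (Var 0) \<^bold>\<and> val F (Var 2) (Var 1) (Var 0) \<^bold>\<longrightarrow>
         Var 4 \<^bold>= Var 2 \<^bold>\<and> Var 3 \<^bold>= Var 1)))))"

definition SRRT22 :: form where
  "SRRT22 = SAll (coloring 0 \<^bold>\<and> two_bounded 0 \<^bold>\<and> rainbow_stable 0 \<^bold>\<longrightarrow>
     SEx (infinite_set 0 \<^bold>\<and> rainbow 0 1))"

end

theory Submission
  imports Defs "HOL-Library.Countable_Set"
begin

text \<open>
  By Henkin's completeness theorem it suffices to show that every countable model of
  \<open>RCA\<^sub>0 + SEM\<close> satisfies \<open>SRRT\<^sup>2\<^sub>2\<close>. Given a coloring \<open>f\<close>, orient the pairs recursively: whenever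
  \<open>f(x, s) = f(y, s)\<close> for some \<open>x \<noteq> y\<close>, choose the edges to \<open>s\<close> such that \<open>x\<close>, \<open>y\<close>, \<open>s\<close> form a cycle. By
  2-boundedness these choices do not interfere, and rainbow-stability makes the tournament stable.
  A transitive subtournament then contains no distinct \<open>x\<close>, \<open>y\<close>, \<open>s\<close> with \<open>f(x, s) = f(y, s)\<close>, and a
  greedy thinning removes the equalities \<open>f(x, s) = f(y, t)\<close> with \<open>s < t\<close>.
\<close>

section \<open>Substitution\<close>

text \<open>The numbers of a model need not be standard, so they admit only induction for
  \<open>Sigma01\<close> formulas, and every set must come from comprehension. Definability is
  therefore tracked explicitly: \<open>Delta0\<close> lets it be checked by introduction rules.
  Orientation, thinning and the counting behind the pigeonhole principle all decide a number from
  the decisions on smaller ones, so a single recursion theorem, \<open>recursive_set\<close>, serves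
  all three. It needs initial segments coded by numbers, which a divisibility form of Goedel's beta
  function supplies. Comparing two colors means searching for the common one, which has no bound. As
  colorings are total and single-valued, the comparison still forms a set, and with that set as a
  parameter the later definitions are bounded. Stability has a simple source: if \<open>y\<close> is
  the partner of \<open>x\<close> at all large \<open>s\<close>, then the edge between
  \<open>x\<close> and \<open>s\<close> copies or reverses the one fixed edge between
  \<open>x\<close> and \<open>y\<close>; if \<open>x\<close> has no partner at large
  \<open>s\<close>, the edge takes the default direction, upwards.\<close>

lemma tsubst_tsubst: "tsubst \<tau> (tsubst \<sigma> t) = tsubst (\<lambda>i. tsubst \<tau> (\<sigma> i)) t"
  by (induction t) auto

lemma tsubst_Var [simp]: "tsubst Var t = t"
  by (induction t) auto

lemma tsubst_case_nat_tlift [simp]: "tsubst (case_nat u \<tau>) (tlift t) = tsubst \<tau> t"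
  by (simp add: tlift_def tsubst_tsubst)

lemma tlift_simps [simp]:
  "tlift (Var i) = Var (Suc i)" "tlift Zero = Zero" "tlift One = One"
  "tlift (s \<^bold>+ t) = tlift s \<^bold>+ tlift t" "tlift (s \<^bold>* t) = tlift s \<^bold>* tlift t"
  by (simp_all add: tlift_def)

lemma tlift_tsubst: "tlift (tsubst \<tau> t) = tsubst (\<lambda>i. tlift (\<tau> i)) t"
  by (simp add: tlift_def tsubst_tsubst)

lemma fsubst_fsubst:
  "fsubst \<tau> \<pi> (fsubst \<sigma> \<rho> p) = fsubst (\<lambda>i. tsubst \<tau> (\<sigma> i)) (\<pi> \<circ> \<rho>) p"
proof (induction p arbitrary: \<tau> \<pi> \<sigma> \<rho>)
  case (NAll p)
  have "(\<lambda>i. tsubst (case_nat (Var 0) (tlift \<circ> \<tau>)) (case_nat (Var 0) (tlift \<circ> \<sigma>) i)) =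
    case_nat (Var 0) (tlift \<circ> (\<lambda>i. tsubst \<tau> (\<sigma> i)))"
    by (rule ext) (simp add: tlift_tsubst comp_def split: nat.split)
  with NAll show ?case by simp
next
  case (SAll p)
  have "case_nat 0 (Suc \<circ> \<pi>) \<circ> case_nat 0 (Suc \<circ> \<rho>) = case_nat 0 (Suc \<circ> (\<pi> \<circ> \<rho>))"
    by (rule ext) (simp split: nat.split)
  then show ?case by (simp only: fsubst.simps SAll)
qed (simp_all add: tsubst_tsubst)

lemma fsubst_id [simp]: "fsubst Var id p = p"
proof (induction p)
  case (NAll p)
  have "case_nat (Var 0) (tlift \<circ> Var) = Var"
    by (rule ext) (simp split: nat.split)
  with NAll show ?case by simp
next
  case (SAll p)
  have "case_nat 0 (Suc \<circ> id) = id"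
    by (rule ext) (simp split: nat.split)
  then show ?case by (simp only: fsubst.simps SAll)
qed simp_all

lemma tsubst_cong: "tclosed n t \<Longrightarrow> (\<And>i. i < n \<Longrightarrow> \<sigma> i = \<tau> i) \<Longrightarrow> tsubst \<sigma> t = tsubst \<tau> t"
  by (induction t) auto

text \<open>Needed for substitutions that differ only at indices that do not occur: sentences become
  invariant under all of them, and a fresh variable can be renamed freely.\<close>

lemma fsubst_cong:
  "fclosed n m p \<Longrightarrow> (\<And>i. i < n \<Longrightarrow> \<sigma> i = \<tau> i) \<Longrightarrow> (\<And>j. j < m \<Longrightarrow> \<rho> j = \<pi> j) \<Longrightarrow>
    fsubst \<sigma> \<rho> p = fsubst \<tau> \<pi> p"
proof (induction p arbitrary: n m \<sigma> \<rho> \<tau> \<pi>)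
  case (NAll p)
  have "fsubst (case_nat (Var 0) (tlift \<circ> \<sigma>)) \<rho> p = fsubst (case_nat (Var 0) (tlift \<circ> \<tau>)) \<pi> p"
    using NAll.prems by (intro NAll.IH[of "Suc n" m]) (auto split: nat.split)
  then show ?case by simp
next
  case (SAll p)
  have "fsubst \<sigma> (case_nat 0 (Suc \<circ> \<rho>)) p = fsubst \<tau> (case_nat 0 (Suc \<circ> \<pi>)) p"
    using SAll.prems by (intro SAll.IH[of n "Suc m"]) (auto split: nat.split)
  then show ?case by simp
next
  case (Imp p q)
  then show ?case by (metis fclosed.simps(5) fsubst.simps(5))
qed (simp_all, (metis tsubst_cong)+)

lemma tclosed_mono: "tclosed n t \<Longrightarrow> n \<le> n' \<Longrightarrow> tclosed n' t"
  by (induction t) auto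

lemma fclosed_mono: "fclosed n m p \<Longrightarrow> n \<le> n' \<Longrightarrow> m \<le> m' \<Longrightarrow> fclosed n' m' p"
  by (induction p arbitrary: n m n' m') (auto intro: tclosed_mono)

lemma tclosed_exists: "\<exists>n. tclosed n t"
proof (induction t)
  case (Var i)
  then show ?case by (auto intro: exI[of _ "Suc i"])
next
  case (Add s t)
  then obtain n n' where "tclosed n s" "tclosed n' t" by blast
  then have "tclosed (max n n') s" "tclosed (max n n') t"
    by (meson tclosed_mono max.cobounded1 max.cobounded2)+
  then show ?case by auto
next
  case (Mul s t)
  then obtain n n' where "tclosed n s" "tclosed n' t" by blast
  then have "tclosed (max n n') s" "tclosed (max n n') t"
    by (meson tclosed_mono max.cobounded1 max.cobounded2)+
  then show ?case by auto
qed auto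

lemma fclosed_exists: "\<exists>n m. fclosed n m p"
proof (induction p)
  case (Eq s t)
  obtain n n' where "tclosed n s" "tclosed n' t" using tclosed_exists by blast
  then have "tclosed (max n n') s" "tclosed (max n n') t"
    by (meson tclosed_mono max.cobounded1 max.cobounded2)+
  then show ?case by auto
next
  case (Less s t)
  obtain n n' where "tclosed n s" "tclosed n' t" using tclosed_exists by blast
  then have "tclosed (max n n') s" "tclosed (max n n') t"
    by (meson tclosed_mono max.cobounded1 max.cobounded2)+
  then show ?case by auto
next
  case (Mem t X)
  then show ?case using tclosed_exists[of t] by auto
next
  case (Imp p q)
  then obtain n m n' m' where "fclosed n m p" "fclosed n' m' q" by blast
  then have "fclosed (max n n') (max m m') p" "fclosed (max n n') (max m m') q"
    by (meson fclosed_mono max.cobounded1 max.cobounded2)+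
  then show ?case by auto
next
  case (NAll p)
  then obtain n m where "fclosed n m p" by blast
  then have "fclosed (Suc n) m p" by (rule fclosed_mono) auto
  then show ?case by auto
next
  case (SAll p)
  then obtain n m where "fclosed n m p" by blast
  then have "fclosed n (Suc m) p" by (rule fclosed_mono) auto
  then show ?case by auto
qed auto

lemma nlift_fsubst: "fsubst (case_nat (Var 0) (tlift \<circ> \<sigma>)) \<rho> (nlift p) = nlift (fsubst \<sigma> \<rho> p)"
  by (simp add: nlift_def fsubst_fsubst comp_def tlift_def)

lemma slift_fsubst: "fsubst \<sigma> (case_nat 0 (Suc \<circ> \<rho>)) (slift p) = slift (fsubst \<sigma> \<rho> p)"
  by (simp add: slift_def fsubst_fsubst comp_def)

text \<open>Instantiating after a substitution under the binder, and substituting after an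
  instantiation (\<open>fsubst_ninst\<close>), both collapse to one simultaneous substitution by
  \<open>case_nat\<close>. The quantifier rules are compared in this common form.\<close>

lemma ninst_fsubst_lift:
  "ninst t (fsubst (case_nat (Var 0) (tlift \<circ> \<sigma>)) \<rho> p) = fsubst (case_nat t \<sigma>) \<rho> p"
proof -
  have "(\<lambda>i. tsubst (case_nat t Var) (case_nat (Var 0) (tlift \<circ> \<sigma>) i)) = case_nat t \<sigma>"
    by (rule ext) (simp split: nat.split)
  then show ?thesis by (simp add: ninst_def fsubst_fsubst)
qed

lemma fsubst_ninst: "fsubst \<sigma> \<rho> (ninst t p) = fsubst (case_nat (tsubst \<sigma> t) \<sigma>) \<rho> p"
proof -
  have "(\<lambda>i. tsubst \<sigma> (case_nat t Var i)) = case_nat (tsubst \<sigma> t) \<sigma>"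
    by (rule ext) (simp split: nat.split)
  then show ?thesis by (simp add: ninst_def fsubst_fsubst)
qed

lemma sinst_fsubst_lift:
  "sinst X (fsubst \<sigma> (case_nat 0 (Suc \<circ> \<rho>)) p) = fsubst \<sigma> (case_nat X \<rho>) p"
proof -
  have "case_nat X id \<circ> case_nat 0 (Suc \<circ> \<rho>) = case_nat X \<rho>"
    by (rule ext) (simp split: nat.split)
  then show ?thesis by (simp add: sinst_def fsubst_fsubst)
qed

lemma fsubst_sinst: "fsubst \<sigma> \<rho> (sinst X p) = fsubst \<sigma> (case_nat (\<rho> X) \<rho>) p"
proof -
  have "\<rho> \<circ> case_nat X id = case_nat (\<rho> X) \<rho>"
    by (rule ext) (simp split: nat.split)
  then show ?thesis by (simp add: sinst_def fsubst_fsubst)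
qed

section \<open>Renaming, weakening and compactness of derivations\<close>

lemma proves_fsubst: "\<Gamma> \<turnstile> p \<Longrightarrow> fsubst \<sigma> \<rho> ` \<Gamma> \<turnstile> fsubst \<sigma> \<rho> p"
proof (induction arbitrary: \<sigma> \<rho> rule: proves.induct)
  case (Assm p \<Gamma>)
  then show ?case by (simp add: proves.Assm)
next
  case (ImpI p \<Gamma> q)
  then show ?case by (simp add: proves.ImpI)
next
  case (ImpE \<Gamma> p q)
  then show ?case by (metis fsubst.simps(5) proves.ImpE)
next
  case (Contr p \<Gamma>)
  then show ?case by (metis fsubst.simps(1,5) image_insert proves.Contr)
next
  case (NAllI \<Gamma> p)
  have "fsubst (case_nat (Var 0) (tlift \<circ> \<sigma>)) \<rho> ` nlift ` \<Gamma> = nlift ` fsubst \<sigma> \<rho> ` \<Gamma>"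
    by (simp add: image_image nlift_fsubst)
  then show ?case
    using NAllI.IH[of "case_nat (Var 0) (tlift \<circ> \<sigma>)" \<rho>] by (simp add: proves.NAllI)
next
  case (NAllE \<Gamma> p t)
  then show ?case
    by (metis fsubst.simps(6) fsubst_ninst ninst_fsubst_lift proves.NAllE)
next
  case (SAllI \<Gamma> p)
  have "fsubst \<sigma> (case_nat 0 (Suc \<circ> \<rho>)) ` slift ` \<Gamma> = slift ` fsubst \<sigma> \<rho> ` \<Gamma>"
    by (simp add: image_image slift_fsubst)
  then show ?case
    using SAllI.IH[of \<sigma> "case_nat 0 (Suc \<circ> \<rho>)"] by (simp add: proves.SAllI)
next
  case (SAllE \<Gamma> p X)
  then show ?case
    by (metis fsubst.simps(7) fsubst_sinst sinst_fsubst_lift proves.SAllE)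
next
  case (EqRefl \<Gamma> t)
  then show ?case by (simp add: proves.EqRefl)
next
  case (EqSubst \<Gamma> s t p)
  \<comment> \<open>Leibniz's rule needs both images as instances of a single formula, so the
    substitution is moved under the index that stands for the replaced term.\<close>
  let ?p = "fsubst (case_nat (Var 0) (tlift \<circ> \<sigma>)) \<rho> p"
  have "fsubst \<sigma> \<rho> ` \<Gamma> \<turnstile> ninst (tsubst \<sigma> t) ?p"
  proof (rule proves.EqSubst)
    show "fsubst \<sigma> \<rho> ` \<Gamma> \<turnstile> tsubst \<sigma> s \<^bold>= tsubst \<sigma> t"
      using EqSubst.IH(1)[of \<sigma> \<rho>] by simp
    show "fsubst \<sigma> \<rho> ` \<Gamma> \<turnstile> ninst (tsubst \<sigma> s) ?p"
      using EqSubst.IH(2)[of \<sigma> \<rho>] by (simp add: fsubst_ninst ninst_fsubst_lift)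
  qed
  then show ?case by (simp add: fsubst_ninst ninst_fsubst_lift)
qed

lemma proves_mono: "\<Gamma> \<turnstile> p \<Longrightarrow> \<Gamma> \<subseteq> \<Delta> \<Longrightarrow> \<Delta> \<turnstile> p"
proof (induction arbitrary: \<Delta> rule: proves.induct)
  case (ImpI p \<Gamma> q)
  then show ?case by (meson insert_mono proves.ImpI)
next
  case (Contr p \<Gamma>)
  then show ?case by (meson insert_mono proves.Contr)
next
  case (NAllI \<Gamma> p)
  then show ?case by (meson image_mono proves.NAllI)
next
  case (SAllI \<Gamma> p)
  then show ?case by (meson image_mono proves.SAllI)
next
  case (ImpE \<Gamma> p q)
  then show ?case using proves.ImpE by metis
next
  case (EqSubst \<Gamma> s t p)
  then show ?case using proves.EqSubst[of \<Delta> s t p] by metis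
qed (auto intro: proves.Assm proves.EqRefl proves.NAllE proves.SAllE)

text \<open>A derivation mentions finitely many assumptions; below a quantifier rule these are
  lifted formulas, and finitely many preimages suffice. This makes the union of the Henkin chain
  consistent.\<close>

lemma proves_finite: "\<Gamma> \<turnstile> p \<Longrightarrow> \<exists>\<Delta>. finite \<Delta> \<and> \<Delta> \<subseteq> \<Gamma> \<and> \<Delta> \<turnstile> p"
proof (induction rule: proves.induct)
  case (Assm p \<Gamma>)
  then show ?case by (intro exI[of _ "{p}"]) (auto intro: proves.Assm)
next
  case (ImpI p \<Gamma> q)
  then obtain \<Delta> where "finite \<Delta>" "\<Delta> \<subseteq> insert p \<Gamma>" "\<Delta> \<turnstile> q" by blast
  moreover have "insert p (\<Delta> - {p}) \<turnstile> q"
    by (rule proves_mono[OF \<open>\<Delta> \<turnstile> q\<close>]) blast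
  ultimately show ?case
    using proves.ImpI[of p "\<Delta> - {p}" q] by (intro exI[of _ "\<Delta> - {p}"]) blast
next
  case (ImpE \<Gamma> p q)
  then obtain \<Delta> \<Delta>' where "finite \<Delta>" "\<Delta> \<subseteq> \<Gamma>" "\<Delta> \<turnstile> p \<^bold>\<longrightarrow> q" "finite \<Delta>'" "\<Delta>' \<subseteq> \<Gamma>" "\<Delta>' \<turnstile> p"
    by blast
  then show ?case
    using proves.ImpE[of "\<Delta> \<union> \<Delta>'" p q] proves_mono[of _ _ "\<Delta> \<union> \<Delta>'"]
    by (intro exI[of _ "\<Delta> \<union> \<Delta>'"]) blast
next
  case (Contr p \<Gamma>)
  then obtain \<Delta> where "finite \<Delta>" "\<Delta> \<subseteq> insert (\<^bold>\<not> p) \<Gamma>" "\<Delta> \<turnstile> Bot" by blast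
  moreover have "insert (\<^bold>\<not> p) (\<Delta> - {\<^bold>\<not> p}) \<turnstile> Bot"
    by (rule proves_mono[OF \<open>\<Delta> \<turnstile> Bot\<close>]) blast
  ultimately show ?case
    using proves.Contr[of p "\<Delta> - {\<^bold>\<not> p}"] by (intro exI[of _ "\<Delta> - {\<^bold>\<not> p}"]) blast
next
  case (NAllI \<Gamma> p)
  then obtain \<Delta> where "finite \<Delta>" "\<Delta> \<subseteq> nlift ` \<Gamma>" "\<Delta> \<turnstile> p" by blast
  then obtain \<Delta>' where "finite \<Delta>'" "\<Delta>' \<subseteq> \<Gamma>" "nlift ` \<Delta>' \<turnstile> p"
    by (metis finite_subset_image)
  then show ?case using proves.NAllI by blast
next
  case (SAllI \<Gamma> p)
  then obtain \<Delta> where "finite \<Delta>" "\<Delta> \<subseteq> slift ` \<Gamma>" "\<Delta> \<turnstile> p" by blast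
  then obtain \<Delta>' where "finite \<Delta>'" "\<Delta>' \<subseteq> \<Gamma>" "slift ` \<Delta>' \<turnstile> p"
    by (metis finite_subset_image)
  then show ?case using proves.SAllI by blast
next
  case (EqRefl \<Gamma> t)
  then show ?case by (meson empty_subsetI finite.emptyI proves.EqRefl)
next
  case (EqSubst \<Gamma> s t p)
  then obtain \<Delta> \<Delta>' where "finite \<Delta>" "\<Delta> \<subseteq> \<Gamma>" "\<Delta> \<turnstile> s \<^bold>= t" "finite \<Delta>'" "\<Delta>' \<subseteq> \<Gamma>" "\<Delta>' \<turnstile> ninst s p"
    by blast
  then show ?case
    using proves.EqSubst[of "\<Delta> \<union> \<Delta>'" s t p] proves_mono[of _ _ "\<Delta> \<union> \<Delta>'"]
    by (intro exI[of _ "\<Delta> \<union> \<Delta>'"]) blast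
next
  case (NAllE \<Gamma> p t)
  then show ?case using proves.NAllE by metis
next
  case (SAllE \<Gamma> p X)
  then show ?case using proves.SAllE by metis
qed

lemma Bot_elim: "\<Gamma> \<turnstile> Bot \<Longrightarrow> \<Gamma> \<turnstile> p"
  by (meson proves.Contr proves_mono subset_insertI)

section \<open>Henkin completion\<close>

lemma fsubst_swap_fresh:
  assumes "fclosed n m p"
  shows "fsubst (\<lambda>i. if i = n then Var 0 else Var (Suc i)) id p = nlift p"
  unfolding nlift_def by (rule fsubst_cong[OF assms]) auto

text \<open>The calculus generalizes over index \<open>0\<close> after lifting the assumptions.
  Renaming \<open>n\<close> to \<open>0\<close> and shifting all other indices acts on formulas
  without \<open>n\<close> exactly like this lift, and it turns the instance at \<open>n\<close>
  back into \<open>p\<close>.\<close>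

lemma NAllI_fresh:
  assumes \<Gamma>: "\<And>q. q \<in> \<Gamma> \<Longrightarrow> fclosed n m q" and p: "fclosed (Suc n) m p" and d: "\<Gamma> \<turnstile> ninst (Var n) p"
  shows "\<Gamma> \<turnstile> NAll p"
proof -
  let ?\<sigma> = "\<lambda>i. if i = n then Var 0 else Var (Suc i)"
  have "fsubst ?\<sigma> id ` \<Gamma> = nlift ` \<Gamma>"
    using \<Gamma> by (intro image_cong refl fsubst_swap_fresh) auto
  moreover have "fsubst ?\<sigma> id (ninst (Var n) p) = fsubst Var id p"
    unfolding fsubst_ninst by (rule fsubst_cong[OF p]) (auto split: nat.split)
  ultimately show ?thesis
    using proves_fsubst[OF d, of ?\<sigma> id] by (simp add: proves.NAllI)
qed

lemma SAllI_fresh: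
  assumes \<Gamma>: "\<And>q. q \<in> \<Gamma> \<Longrightarrow> fclosed n m q" and p: "fclosed n (Suc m) p" and d: "\<Gamma> \<turnstile> sinst m p"
  shows "\<Gamma> \<turnstile> SAll p"
proof -
  let ?\<rho> = "\<lambda>i. if i = m then 0 else Suc i"
  have "fsubst Var ?\<rho> ` \<Gamma> = slift ` \<Gamma>"
    unfolding slift_def by (intro image_cong refl fsubst_cong[OF \<Gamma>]) auto
  moreover have "fsubst Var ?\<rho> (sinst m p) = fsubst Var id p"
    unfolding fsubst_sinst by (rule fsubst_cong[OF p]) (auto split: nat.split)
  ultimately show ?thesis
    using proves_fsubst[OF d, of Var ?\<rho>] by (simp add: proves.SAllI)
qed

definition consistent :: "form set \<Rightarrow> bool" where
  "consistent \<Gamma> \<longleftrightarrow> \<not> \<Gamma> \<turnstile> Bot"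

text \<open>A common bound on the free indices leaves fresh variables at every stage. These play the
  role of Henkin constants, so the language is never extended.\<close>

definition closed_below :: "nat \<Rightarrow> nat \<Rightarrow> form set \<Rightarrow> bool" where
  "closed_below n m \<Gamma> \<longleftrightarrow> (\<forall>p\<in>\<Gamma>. fclosed n m p)"

definition henkin_step :: "form \<Rightarrow> form set \<Rightarrow> form set \<Rightarrow> bool" where
  "henkin_step p \<Gamma> \<Delta> \<longleftrightarrow> \<Gamma> \<subseteq> \<Delta> \<and> consistent \<Delta> \<and> (\<exists>n m. closed_below n m \<Delta>) \<and>
    (p \<in> \<Delta> \<or> \<^bold>\<not> p \<in> \<Delta>) \<and>
    (\<forall>q. p = NAll q \<longrightarrow> \<^bold>\<not> p \<in> \<Delta> \<longrightarrow> (\<exists>t. \<^bold>\<not> ninst t q \<in> \<Delta>)) \<and>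
    (\<forall>q. p = SAll q \<longrightarrow> \<^bold>\<not> p \<in> \<Delta> \<longrightarrow> (\<exists>X. \<^bold>\<not> sinst X q \<in> \<Delta>))"

lemma closed_below_insert:
  assumes "\<exists>n m. closed_below n m \<Gamma>"
  shows "\<exists>n m. closed_below n m (insert p \<Gamma>)"
proof -
  obtain n m n' m' where *: "closed_below n m \<Gamma>" "fclosed n' m' p"
    using assms fclosed_exists by blast
  have "closed_below (max n n') (max m m') (insert p \<Gamma>)"
    using * unfolding closed_below_def by (auto intro: fclosed_mono)
  then show ?thesis by blast
qed

lemma consistent_insert_Neg: "consistent (insert (\<^bold>\<not> p) \<Gamma>) \<longleftrightarrow> \<not> \<Gamma> \<turnstile> p"
proof -
  have "insert (\<^bold>\<not> p) \<Gamma> \<turnstile> Bot" if "\<Gamma> \<turnstile> p"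
    using that by (meson insertI1 proves.Assm proves.ImpE proves_mono subset_insertI)
  then show ?thesis unfolding consistent_def by (meson proves.Contr)
qed

text \<open>If \<open>p\<close> cannot be added, its negation can. If moreover \<open>p\<close> is
  universal, the negated instance at a fresh variable can be added too: otherwise that instance
  would be derivable, and generalization would yield \<open>p\<close>.\<close>

lemma henkin_step_exists:
  assumes con: "consistent \<Gamma>" and cl: "\<exists>n m. closed_below n m \<Gamma>"
  shows "\<exists>\<Delta>. henkin_step p \<Gamma> \<Delta>"
proof (cases "consistent (insert p \<Gamma>)")
  case True
  have "\<^bold>\<not> p \<notin> insert p \<Gamma>"
  proof
    assume "\<^bold>\<not> p \<in> insert p \<Gamma>"
    then have "insert p \<Gamma> \<turnstile> Bot" by (meson insertI1 proves.Assm proves.ImpE)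
    with True show False unfolding consistent_def by blast
  qed
  then show ?thesis
    using True closed_below_insert[OF cl, of p]
    by (intro exI[of _ "insert p \<Gamma>"]) (auto simp: henkin_step_def)
next
  case False
  let ?\<Delta> = "insert (\<^bold>\<not> p) \<Gamma>"
  have np: "\<not> \<Gamma> \<turnstile> p"
    using False con unfolding consistent_def by (meson proves.ImpI proves.ImpE)
  then have con': "consistent ?\<Delta>" by (simp add: consistent_insert_Neg)
  obtain n m where cl': "closed_below n m ?\<Delta>" using closed_below_insert[OF cl] by blast
  then have cl'': "\<And>q. q \<in> ?\<Delta> \<Longrightarrow> fclosed n m q" unfolding closed_below_def by blast
  have np': "\<not> ?\<Delta> \<turnstile> p"
    using con' unfolding consistent_def by (meson insertI1 proves.Assm proves.ImpE)
  consider (N) q where "p = NAll q" | (S) q where "p = SAll q" | (O) "\<nexists>q. p = NAll q" "\<nexists>q. p = SAll q"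
    by blast
  then show ?thesis
  proof cases
    case N
    have "\<not> ?\<Delta> \<turnstile> ninst (Var n) q"
      using NAllI_fresh[of ?\<Delta> n m q] cl'' cl''[of "\<^bold>\<not> NAll q"] np' N by auto
    then have "consistent (insert (\<^bold>\<not> ninst (Var n) q) ?\<Delta>)" by (simp add: consistent_insert_Neg)
    then show ?thesis
      using N closed_below_insert[OF closed_below_insert[OF cl]]
      by (intro exI[of _ "insert (\<^bold>\<not> ninst (Var n) q) ?\<Delta>"]) (auto simp: henkin_step_def)
  next
    case S
    have "\<not> ?\<Delta> \<turnstile> sinst m q"
      using SAllI_fresh[of ?\<Delta> n m q] cl'' cl''[of "\<^bold>\<not> SAll q"] np' S by auto
    then have "consistent (insert (\<^bold>\<not> sinst m q) ?\<Delta>)" by (simp add: consistent_insert_Neg)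
    then show ?thesis
      using S closed_below_insert[OF closed_below_insert[OF cl]]
      by (intro exI[of _ "insert (\<^bold>\<not> sinst m q) ?\<Delta>"]) (auto simp: henkin_step_def)
  next
    case O
    then show ?thesis
      using con' cl' by (intro exI[of _ ?\<Delta>]) (auto simp: henkin_step_def)
  qed
qed

instance tm :: countable by countable_datatype
instance form :: countable by countable_datatype

locale henkin =
  fixes \<Theta> :: "form set"
  assumes con: "consistent \<Theta>"
    and complete: "\<And>p. p \<in> \<Theta> \<or> \<^bold>\<not> p \<in> \<Theta>"
    and NAll_witness: "\<And>p. \<^bold>\<not> NAll p \<in> \<Theta> \<Longrightarrow> \<exists>t. \<^bold>\<not> ninst t p \<in> \<Theta>"
    and SAll_witness: "\<And>p. \<^bold>\<not> SAll p \<in> \<Theta> \<Longrightarrow> \<exists>X. \<^bold>\<not> sinst X p \<in> \<Theta>"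

lemma henkin_extension:
  assumes con: "consistent \<Gamma>" and cl: "\<And>p. p \<in> \<Gamma> \<Longrightarrow> sentence p"
  shows "\<exists>\<Theta>. \<Gamma> \<subseteq> \<Theta> \<and> henkin \<Theta>"
proof -
  let ?P = "\<lambda>n \<Delta>. consistent \<Delta> \<and> (\<exists>n m. closed_below n m \<Delta>) \<and> \<Gamma> \<subseteq> \<Delta>"
  have "\<exists>f. \<forall>n. ?P n (f n) \<and> henkin_step (from_nat n) (f n) (f (Suc n))"
  proof (rule dependent_nat_choice)
    have "closed_below 0 0 \<Gamma>" using cl by (simp add: closed_below_def sentence_def)
    then show "\<exists>x. ?P 0 x" using con by blast
  next
    fix x n
    assume "?P n x"
    moreover then obtain y where "henkin_step (from_nat n) x y" using henkin_step_exists by blast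
    ultimately show "\<exists>y. ?P (Suc n) y \<and> henkin_step (from_nat n) x y"
      unfolding henkin_step_def by blast
  qed
  then obtain f where f: "\<And>n. ?P n (f n)" "\<And>n. henkin_step (from_nat n) (f n) (f (Suc n))"
    by blast
  have "f n \<subseteq> f (Suc n)" for n
    using f(2)[of n] unfolding henkin_step_def by blast
  then have mono: "mono f"
    by (simp add: mono_iff_le_Suc)
  let ?\<Theta> = "\<Union> (range f)"
  have sub: "\<exists>n. \<Delta> \<subseteq> f n" if "finite \<Delta>" "\<Delta> \<subseteq> ?\<Theta>" for \<Delta>
    using that
  proof (induction \<Delta> rule: finite_induct)
    case (insert x F)
    then obtain n k where "F \<subseteq> f n" "x \<in> f k" by auto
    then have "insert x F \<subseteq> f (max n k)"
      using monoD[OF mono, of n "max n k"] monoD[OF mono, of k "max n k"] by auto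
    then show ?case by blast
  qed auto
  have con\<Theta>: "consistent ?\<Theta>"
    unfolding consistent_def
  proof
    assume "?\<Theta> \<turnstile> Bot"
    then obtain \<Delta> where "finite \<Delta>" "\<Delta> \<subseteq> ?\<Theta>" "\<Delta> \<turnstile> Bot" using proves_finite by blast
    then obtain n where "f n \<turnstile> Bot" using sub proves_mono by meson
    then show False using f(1)[of n] unfolding consistent_def by blast
  qed
  have step: "henkin_step p (f (to_nat p)) (f (Suc (to_nat p)))" for p
    using f(2)[of "to_nat p"] by simp
  have comp: "p \<in> ?\<Theta> \<or> \<^bold>\<not> p \<in> ?\<Theta>" for p
    using step[of p] unfolding henkin_step_def by blast
  \<comment> \<open>A negation in the union is already present after the stage of \<open>p\<close>:
    otherwise that stage would have put in \<open>p\<close>, making the union inconsistent. Hence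
    the same stage also supplied the counterexample.\<close>
  have neg: "\<^bold>\<not> p \<in> f (Suc (to_nat p))" if "\<^bold>\<not> p \<in> ?\<Theta>" for p
  proof (rule ccontr)
    assume "\<^bold>\<not> p \<notin> f (Suc (to_nat p))"
    then have "p \<in> ?\<Theta>" using step[of p] unfolding henkin_step_def by blast
    then have "?\<Theta> \<turnstile> Bot" using that by (meson proves.Assm proves.ImpE)
    then show False using con\<Theta> unfolding consistent_def by blast
  qed
  have "henkin ?\<Theta>"
  proof
    fix p
    assume *: "\<^bold>\<not> NAll p \<in> ?\<Theta>"
    show "\<exists>t. \<^bold>\<not> ninst t p \<in> ?\<Theta>"
      using step[of "NAll p"] neg[OF *] unfolding henkin_step_def by blast
  next
    fix p
    assume *: "\<^bold>\<not> SAll p \<in> ?\<Theta>"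
    show "\<exists>t. \<^bold>\<not> sinst t p \<in> ?\<Theta>"
      using step[of "SAll p"] neg[OF *] unfolding henkin_step_def by blast
  qed (use con\<Theta> comp in auto)
  then show ?thesis using f(1)[of 0] by blast
qed

section \<open>Structures and the canonical model\<close>

text \<open>Sets are abstract objects with a membership relation, because in the canonical model
  they are the set variables, several of which may have the same elements.\<close>

locale interp =
  fixes zero one :: 'a and add mul :: "'a \<Rightarrow> 'a \<Rightarrow> 'a" and less :: "'a \<Rightarrow> 'a \<Rightarrow> bool"
    and mem :: "'a \<Rightarrow> 's \<Rightarrow> bool"
begin

primrec teval :: "(nat \<Rightarrow> 'a) \<Rightarrow> tm \<Rightarrow> 'a" where
  "teval e (Var i) = e i"
| "teval e Zero = zero"
| "teval e One = one"
| "teval e (s \<^bold>+ t) = add (teval e s) (teval e t)"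
| "teval e (s \<^bold>* t) = mul (teval e s) (teval e t)"

primrec sat :: "(nat \<Rightarrow> 'a) \<Rightarrow> (nat \<Rightarrow> 's) \<Rightarrow> form \<Rightarrow> bool" where
  "sat e S Bot \<longleftrightarrow> False"
| "sat e S (s \<^bold>= t) \<longleftrightarrow> teval e s = teval e t"
| "sat e S (s \<^bold>< t) \<longleftrightarrow> less (teval e s) (teval e t)"
| "sat e S (t \<^bold>\<in> X) \<longleftrightarrow> mem (teval e t) (S X)"
| "sat e S (p \<^bold>\<longrightarrow> q) \<longleftrightarrow> (sat e S p \<longrightarrow> sat e S q)"
| "sat e S (NAll p) \<longleftrightarrow> (\<forall>x. sat (case_nat x e) S p)"
| "sat e S (SAll p) \<longleftrightarrow> (\<forall>X. sat e (case_nat X S) p)"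

lemma teval_tsubst: "teval e (tsubst \<sigma> t) = teval (\<lambda>i. teval e (\<sigma> i)) t"
  by (induction t) auto

lemma teval_tlift [simp]: "teval e (tlift t) = teval (\<lambda>i. e (Suc i)) t"
  by (simp add: tlift_def teval_tsubst)

lemma sat_fsubst: "sat e S (fsubst \<sigma> \<rho> p) \<longleftrightarrow> sat (\<lambda>i. teval e (\<sigma> i)) (\<lambda>j. S (\<rho> j)) p"
proof (induction p arbitrary: e S \<sigma> \<rho>)
  case (NAll p)
  have "(\<lambda>i. teval (case_nat x e) (case_nat (Var 0) (tlift \<circ> \<sigma>) i)) =
    case_nat x (\<lambda>i. teval e (\<sigma> i))" for x
    by (rule ext) (simp split: nat.split)
  then show ?case by (simp only: fsubst.simps sat.simps NAll)
next
  case (SAll p)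
  have "(\<lambda>j. case_nat X S (case_nat 0 (Suc \<circ> \<rho>) j)) = case_nat X (\<lambda>j. S (\<rho> j))" for X
    by (rule ext) (simp split: nat.split)
  then show ?case by (simp only: fsubst.simps sat.simps SAll)
qed (simp_all add: teval_tsubst)

lemma sat_closure:
  assumes "\<And>e S. sat e S ((SAll ^^ m) ((NAll ^^ n) p))"
  shows "sat e S p"
proof -
  have "(\<forall>e S. sat e S ((SAll ^^ m) q)) \<longrightarrow> (\<forall>e S. sat e S q)" for q
  proof (induction m)
    case (Suc m)
    have "sat e S r" if *: "\<forall>e S. sat e S (SAll r)" for e S r
    proof -
      have "case_nat (S 0) (S \<circ> Suc) = S" by (rule ext) (simp split: nat.split)
      then show ?thesis using * by (metis sat.simps(7))
    qed
    with Suc show ?case by auto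
  qed simp
  moreover have "(\<forall>e S. sat e S ((NAll ^^ n) q)) \<longrightarrow> (\<forall>e S. sat e S q)" for q
  proof (induction n)
    case (Suc n)
    have "sat e S r" if *: "\<forall>e S. sat e S (NAll r)" for e S r
    proof -
      have "case_nat (e 0) (e \<circ> Suc) = e" by (rule ext) (simp split: nat.split)
      then show ?thesis using * by (metis sat.simps(6))
    qed
    with Suc show ?case by auto
  qed simp
  ultimately show ?thesis using assms by blast
qed

end

lemma fclosed_funpow_NAll: "fclosed k l ((NAll ^^ n) p) = fclosed (k + n) l p"
  by (induction n arbitrary: k) auto

lemma fclosed_funpow_SAll: "fclosed k l ((SAll ^^ m) p) = fclosed k (l + m) p"
  by (induction m arbitrary: l) auto

lemma universal_closures_exists:
  assumes "p \<in> A"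
  shows "\<exists>n m. (SAll ^^ m) ((NAll ^^ n) p) \<in> universal_closures A"
proof -
  obtain n m where "fclosed n m p" using fclosed_exists by blast
  then have "sentence ((SAll ^^ m) ((NAll ^^ n) p))"
    by (simp add: sentence_def fclosed_funpow_NAll fclosed_funpow_SAll)
  with assms show ?thesis unfolding universal_closures_def by blast
qed

lemma fsubst_sentence: "sentence p \<Longrightarrow> fsubst \<sigma> \<rho> p = p"
  using fsubst_cong[of 0 0 p \<sigma> Var \<rho> id] by (simp add: sentence_def)

section \<open>Truth conditions and equality in a Henkin set\<close>

context henkin
begin

lemma deduction_closed: "\<Theta> \<turnstile> p \<longleftrightarrow> p \<in> \<Theta>"
  using con complete[of p] proves.ImpE[of \<Theta> p Bot] proves.Assm[of _ \<Theta>]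
  unfolding consistent_def by blast

lemma Bot_notin: "Bot \<notin> \<Theta>"
  using con unfolding consistent_def by (simp add: deduction_closed)

lemma Imp_iff: "(p \<^bold>\<longrightarrow> q) \<in> \<Theta> \<longleftrightarrow> (p \<in> \<Theta> \<longrightarrow> q \<in> \<Theta>)"
proof
  assume "(p \<^bold>\<longrightarrow> q) \<in> \<Theta>"
  then show "p \<in> \<Theta> \<longrightarrow> q \<in> \<Theta>" using proves.ImpE[of \<Theta> p q] by (simp add: deduction_closed)
next
  assume *: "p \<in> \<Theta> \<longrightarrow> q \<in> \<Theta>"
  have "insert p \<Theta> \<turnstile> q"
  proof (cases "p \<in> \<Theta>")
    case True
    with * show ?thesis by (auto intro: proves.Assm)
  next
    case False
    then have "\<^bold>\<not> p \<in> \<Theta>" using complete by blast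
    then have "insert p \<Theta> \<turnstile> Bot" by (meson insertCI proves.Assm proves.ImpE)
    then show ?thesis by (rule Bot_elim)
  qed
  then show "(p \<^bold>\<longrightarrow> q) \<in> \<Theta>" using proves.ImpI deduction_closed by blast
qed

lemma NAll_iff: "NAll p \<in> \<Theta> \<longleftrightarrow> (\<forall>t. ninst t p \<in> \<Theta>)"
  using NAll_witness[of p] complete[of "NAll p"] proves.NAllE[of \<Theta> p]
  by (auto simp: Imp_iff Bot_notin deduction_closed)

lemma SAll_iff: "SAll p \<in> \<Theta> \<longleftrightarrow> (\<forall>X. sinst X p \<in> \<Theta>)"
  using SAll_witness[of p] complete[of "SAll p"] proves.SAllE[of \<Theta> p]
  by (auto simp: Imp_iff Bot_notin deduction_closed)

definition eqv :: "tm \<Rightarrow> tm \<Rightarrow> bool" where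
  "eqv s t \<longleftrightarrow> (s \<^bold>= t) \<in> \<Theta>"

lemma eqv_subst: "eqv s t \<Longrightarrow> ninst s p \<in> \<Theta> \<Longrightarrow> ninst t p \<in> \<Theta>"
  using proves.EqSubst[of \<Theta> s t p] by (simp add: deduction_closed eqv_def)

lemma eqv_refl: "eqv s s"
  using proves.EqRefl[of \<Theta> s] by (simp add: deduction_closed eqv_def)

text \<open>Reflexivity and Leibniz's rule are the only equality rules of the calculus. Symmetry,
  transitivity and the congruences follow by putting \<open>Var 0\<close> where the replacement
  happens and lifted terms elsewhere.\<close>

lemma eqv_sym: "eqv s t \<Longrightarrow> eqv t s"
  using eqv_subst[of s t "Var 0 \<^bold>= tlift s"] eqv_refl[of s] by (simp add: ninst_def eqv_def)

lemma eqv_trans: "eqv s t \<Longrightarrow> eqv t u \<Longrightarrow> eqv s u"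
  using eqv_subst[of t u "tlift s \<^bold>= Var 0"] by (simp add: ninst_def eqv_def)

lemma eqv_Add: "eqv s s' \<Longrightarrow> eqv t t' \<Longrightarrow> eqv (s \<^bold>+ t) (s' \<^bold>+ t')"
  using eqv_subst[of s s' "tlift (s \<^bold>+ t) \<^bold>= Var 0 \<^bold>+ tlift t"]
    eqv_subst[of t t' "tlift (s \<^bold>+ t) \<^bold>= tlift s' \<^bold>+ Var 0"] eqv_refl[of "s \<^bold>+ t"]
  by (simp add: ninst_def eqv_def)

lemma eqv_Mul: "eqv s s' \<Longrightarrow> eqv t t' \<Longrightarrow> eqv (s \<^bold>* t) (s' \<^bold>* t')"
  using eqv_subst[of s s' "tlift (s \<^bold>* t) \<^bold>= Var 0 \<^bold>* tlift t"]
    eqv_subst[of t t' "tlift (s \<^bold>* t) \<^bold>= tlift s' \<^bold>* Var 0"] eqv_refl[of "s \<^bold>* t"]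
  by (simp add: ninst_def eqv_def)

lemma eqv_Less: "eqv s s' \<Longrightarrow> eqv t t' \<Longrightarrow> (s \<^bold>< t) \<in> \<Theta> \<Longrightarrow> (s' \<^bold>< t') \<in> \<Theta>"
  using eqv_subst[of s s' "Var 0 \<^bold>< tlift t"] eqv_subst[of t t' "tlift s' \<^bold>< Var 0"]
  by (simp add: ninst_def)

lemma eqv_Mem: "eqv s s' \<Longrightarrow> (s \<^bold>\<in> X) \<in> \<Theta> \<Longrightarrow> (s' \<^bold>\<in> X) \<in> \<Theta>"
  using eqv_subst[of s s' "Var 0 \<^bold>\<in> X"] by (simp add: ninst_def)

lemma closure_instance:
  assumes "(SAll ^^ m) ((NAll ^^ n) p) \<in> \<Theta>" "sentence ((SAll ^^ m) ((NAll ^^ n) p))"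
  shows "fsubst \<sigma> \<rho> p \<in> \<Theta>"
proof -
  have "(\<forall>\<sigma> \<rho>. fsubst \<sigma> \<rho> ((SAll ^^ m) q) \<in> \<Theta>) \<longrightarrow> (\<forall>\<sigma> \<rho>. fsubst \<sigma> \<rho> q \<in> \<Theta>)" for q
  proof (induction m)
    case (Suc m)
    have "fsubst \<sigma> \<rho> r \<in> \<Theta>" if *: "\<forall>\<sigma> \<rho>. fsubst \<sigma> \<rho> (SAll r) \<in> \<Theta>" for \<sigma> \<rho> r
    proof -
      have "case_nat (\<rho> 0) (\<rho> \<circ> Suc) = \<rho>" by (rule ext) (simp split: nat.split)
      moreover have "fsubst \<sigma> (\<rho> \<circ> Suc) (SAll r) \<in> \<Theta>" using * by blast
      ultimately show ?thesis unfolding fsubst.simps SAll_iff sinst_fsubst_lift by metis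
    qed
    with Suc show ?case by auto
  qed simp
  moreover have "(\<forall>\<sigma> \<rho>. fsubst \<sigma> \<rho> ((NAll ^^ n) q) \<in> \<Theta>) \<longrightarrow> (\<forall>\<sigma> \<rho>. fsubst \<sigma> \<rho> q \<in> \<Theta>)" for q
  proof (induction n)
    case (Suc n)
    have "fsubst \<sigma> \<rho> r \<in> \<Theta>" if *: "\<forall>\<sigma> \<rho>. fsubst \<sigma> \<rho> (NAll r) \<in> \<Theta>" for \<sigma> \<rho> r
    proof -
      have "case_nat (\<sigma> 0) (\<sigma> \<circ> Suc) = \<sigma>" by (rule ext) (simp split: nat.split)
      moreover have "fsubst (\<sigma> \<circ> Suc) \<rho> (NAll r) \<in> \<Theta>" using * by blast
      ultimately show ?thesis unfolding fsubst.simps NAll_iff ninst_fsubst_lift by metis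
    qed
    with Suc show ?case by auto
  qed simp
  moreover have "\<forall>\<sigma> \<rho>. fsubst \<sigma> \<rho> ((SAll ^^ m) ((NAll ^^ n) p)) \<in> \<Theta>"
    using assms(1) fsubst_sentence[OF assms(2)] by simp
  ultimately show ?thesis by blast
qed

end

lemma RCA0_sentence: "q \<in> RCA0 \<Longrightarrow> sentence q"
  by (simp add: RCA0_def universal_closures_def)

locale henkin_RCA0 = henkin +
  assumes RCA0: "RCA0 \<subseteq> \<Theta>"
begin

lemma basic_axiom_instance:
  assumes "p \<in> basic_axioms"
  shows "fsubst \<sigma> \<rho> p \<in> \<Theta>"
proof -
  have "\<exists>n m. (SAll ^^ m) ((NAll ^^ n) p) \<in> RCA0"
    unfolding RCA0_def by (rule universal_closures_exists) (use assms in blast)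
  then obtain n m where "(SAll ^^ m) ((NAll ^^ n) p) \<in> RCA0" by blast
  then have "sentence ((SAll ^^ m) ((NAll ^^ n) p))" "(SAll ^^ m) ((NAll ^^ n) p) \<in> \<Theta>"
    using RCA0 RCA0_sentence by blast+
  then show ?thesis using closure_instance by blast
qed

lemma not_eqv_Zero: "\<not> eqv (t \<^bold>+ One) Zero"
  using basic_axiom_instance[of "\<^bold>\<not> (Var 0 \<^bold>+ One \<^bold>= Zero)" "\<lambda>_. t" id]
  by (simp add: basic_axioms_def eqv_def Imp_iff Bot_notin)

lemma eqv_Suc: "eqv (s \<^bold>+ One) (t \<^bold>+ One) \<Longrightarrow> eqv s t"
  using basic_axiom_instance[of "Var 1 \<^bold>+ One \<^bold>= Var 0 \<^bold>+ One \<^bold>\<longrightarrow> Var 1 \<^bold>= Var 0"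
    "case_nat t (\<lambda>_. s)" id]
  by (simp add: basic_axioms_def eqv_def Imp_iff)

primrec numeral_tm :: "nat \<Rightarrow> tm" where
  "numeral_tm 0 = Zero"
| "numeral_tm (Suc n) = numeral_tm n \<^bold>+ One"

lemma numeral_tm_inj: "eqv (numeral_tm m) (numeral_tm n) \<Longrightarrow> m = n"
proof (induction m arbitrary: n)
  case 0
  then show ?case using not_eqv_Zero eqv_sym by (cases n) auto
next
  case (Suc m)
  then show ?case using not_eqv_Zero eqv_Suc by (cases n) auto
qed

text \<open>The classes of equal terms are to be numbered by all of \<open>nat\<close>. There are
  countably many, and infinitely many because the axioms on successors keep the numerals
  apart.\<close>

lemma canonical_surjection:
  "\<exists>rep :: tm \<Rightarrow> nat. surj rep \<and> (\<forall>s t. rep s = rep t \<longleftrightarrow> eqv s t)"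
proof -
  define cl where "cl s = {t. eqv s t}" for s
  have cl: "cl s = cl t \<longleftrightarrow> eqv s t" for s t
    unfolding cl_def using eqv_refl eqv_sym eqv_trans by blast
  have "inj (cl \<circ> numeral_tm)"
    by (rule injI) (simp add: cl numeral_tm_inj)
  then have "infinite (range (cl \<circ> numeral_tm))" by (rule range_inj_infinite)
  then have "infinite (range cl)" by (rule contrapos_nn) (auto elim: rev_finite_subset)
  then have bij: "bij_betw (to_nat_on (range cl)) (range cl) UNIV"
    by (intro to_nat_on_infinite) auto
  then have "surj (to_nat_on (range cl) \<circ> cl)"
    by (metis bij_betw_imp_surj_on image_comp)
  moreover have "to_nat_on (range cl) (cl s) = to_nat_on (range cl) (cl t) \<longleftrightarrow> eqv s t" for s t
    using bij by (simp add: bij_betw_def inj_on_eq_iff flip: cl)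
  ultimately show ?thesis by (intro exI[of _ "to_nat_on (range cl) \<circ> cl"]) (metis comp_apply)
qed

lemma canonical_model:
  "\<exists>(zero :: nat) one add mul less (mem :: nat \<Rightarrow> nat \<Rightarrow> bool).
    \<forall>p. sentence p \<longrightarrow> (\<forall>e S. interp.sat zero one add mul less mem e S p \<longleftrightarrow> p \<in> \<Theta>)"
proof -
  obtain rep :: "tm \<Rightarrow> nat" where "surj rep" and rep: "\<And>s t. rep s = rep t \<longleftrightarrow> eqv s t"
    using canonical_surjection by blast
  \<comment> \<open>\<open>ab\<close> chooses a representing term for each element.\<close>
  then obtain ab where ab: "\<And>n. rep (ab n) = n" by (metis surj_f_inv_f)
  have ab_rep: "eqv (ab (rep t)) t" for t
    by (simp add: ab flip: rep)
  define add where "add a b = rep (ab a \<^bold>+ ab b)" for a b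
  define mul where "mul a b = rep (ab a \<^bold>* ab b)" for a b
  define less where "less a b \<longleftrightarrow> (ab a \<^bold>< ab b) \<in> \<Theta>" for a b
  define mem where "mem a X \<longleftrightarrow> (ab a \<^bold>\<in> X) \<in> \<Theta>" for a and X :: nat
  interpret M: interp "rep Zero" "rep One" add mul less mem .
  have teval: "M.teval e t = rep (tsubst (\<lambda>i. ab (e i)) t)" for e t
  proof (induction t)
    case (Add s t)
    have "add (rep a) (rep b) = rep (a \<^bold>+ b)" for a b
      by (simp add: add_def rep eqv_Add ab_rep)
    with Add show ?case by simp
  next
    case (Mul s t)
    have "mul (rep a) (rep b) = rep (a \<^bold>* b)" for a b
      by (simp add: mul_def rep eqv_Mul ab_rep)
    with Mul show ?case by simp
  qed (simp_all add: ab)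
  have less: "less (rep s) (rep t) \<longleftrightarrow> (s \<^bold>< t) \<in> \<Theta>" for s t
    unfolding less_def using ab_rep eqv_Less eqv_sym by meson
  have mem: "mem (rep t) X \<longleftrightarrow> (t \<^bold>\<in> X) \<in> \<Theta>" for t X
    unfolding mem_def using ab_rep eqv_Mem eqv_sym by meson
  \<comment> \<open>Truth lemma: each number variable is replaced by a term for its value, while set
    variables denote themselves up to the renaming \<open>S\<close>. On sentences the substitution
    disappears.\<close>
  have sat: "M.sat e S p \<longleftrightarrow> fsubst (\<lambda>i. ab (e i)) S p \<in> \<Theta>" for e S p
  proof (induction p arbitrary: e S)
    case (NAll p)
    let ?p = "fsubst (case_nat (Var 0) (tlift \<circ> (\<lambda>i. ab (e i)))) S p"
    have "M.sat (case_nat x e) S p \<longleftrightarrow> ninst (ab x) ?p \<in> \<Theta>" for x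
    proof -
      have "(\<lambda>i. ab (case_nat x e i)) = case_nat (ab x) (\<lambda>i. ab (e i))"
        by (rule ext) (simp split: nat.split)
      then show ?thesis by (simp only: NAll ninst_fsubst_lift)
    qed
    \<comment> \<open>Every term equals a representative, so ranging over elements is the same as
      ranging over terms.\<close>
    moreover have "(\<forall>x. ninst (ab x) ?p \<in> \<Theta>) \<longleftrightarrow> (\<forall>t. ninst t ?p \<in> \<Theta>)"
      using ab_rep eqv_subst by blast
    ultimately show ?case by (simp add: NAll_iff)
  next
    case (SAll p)
    have "M.sat e (case_nat X S) p \<longleftrightarrow> sinst X (fsubst (\<lambda>i. ab (e i)) (case_nat 0 (Suc \<circ> S)) p) \<in> \<Theta>" for X
      by (simp only: SAll sinst_fsubst_lift)
    then show ?case by (simp add: SAll_iff)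
  qed (simp_all add: teval rep less mem Bot_notin Imp_iff flip: eqv_def)
  show ?thesis
    by (intro exI[of _ "rep Zero"] exI[of _ "rep One"] exI[of _ add] exI[of _ mul] exI[of _ less]
        exI[of _ mem]) (simp add: sat fsubst_sentence)
qed

end

lemma model_existence:
  assumes "consistent \<Gamma>" "\<And>p. p \<in> \<Gamma> \<Longrightarrow> sentence p" "RCA0 \<subseteq> \<Gamma>"
  shows "\<exists>(zero :: nat) one add mul less (mem :: nat \<Rightarrow> nat \<Rightarrow> bool).
    \<forall>p\<in>\<Gamma>. \<forall>e S. interp.sat zero one add mul less mem e S p"
proof -
  obtain \<Theta> where \<Theta>: "\<Gamma> \<subseteq> \<Theta>" "henkin \<Theta>" using henkin_extension[OF assms(1,2)] by blast
  interpret henkin_RCA0 \<Theta>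
    using \<Theta> assms(3) by (auto simp: henkin_RCA0_def henkin_RCA0_axioms_def)
  show ?thesis using canonical_model assms(2) \<Theta>(1) by (meson subsetD)
qed

section \<open>Bounded definability in a countable model\<close>

text \<open>
  Environments are read through de Bruijn indices: \<open>Delta0 k P\<close> says that \<open>P\<close> depends on the indices
  below \<open>k\<close> by a bounded formula. Arbitrary elements and sets may occur as parameters. This is
  no restriction on the logical side because a countable model can be enumerated by the
  remaining indices.
\<close>

locale RCA0_model = interp zero one add mul less mem
  for zero :: "'a :: countable" and one add mul less and mem :: "'a \<Rightarrow> 's :: countable \<Rightarrow> bool" +
  assumes RCA0_sat: "p \<in> RCA0 \<Longrightarrow> sat e S p"
begin

notation zero ("\<zero>") and one ("\<one>") and add (infixl "\<oplus>" 65) and mul (infixl "\<otimes>" 70)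
  and less (infix "\<prec>" 50)

inductive term_def :: "nat \<Rightarrow> ((nat \<Rightarrow> 'a) \<Rightarrow> 'a) \<Rightarrow> bool" where
  term_var: "i < k \<Longrightarrow> term_def k (\<lambda>e. e i)"
| term_const: "term_def k (\<lambda>e. c)"
| term_add: "term_def k f \<Longrightarrow> term_def k g \<Longrightarrow> term_def k (\<lambda>e. f e \<oplus> g e)"
| term_mul: "term_def k f \<Longrightarrow> term_def k g \<Longrightarrow> term_def k (\<lambda>e. f e \<otimes> g e)"

inductive Delta0 :: "nat \<Rightarrow> ((nat \<Rightarrow> 'a) \<Rightarrow> bool) \<Rightarrow> bool" where
  D_False: "Delta0 k (\<lambda>e. False)"
| D_eq: "term_def k f \<Longrightarrow> term_def k g \<Longrightarrow> Delta0 k (\<lambda>e. f e = g e)"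
| D_less: "term_def k f \<Longrightarrow> term_def k g \<Longrightarrow> Delta0 k (\<lambda>e. f e \<prec> g e)"
| D_mem: "term_def k f \<Longrightarrow> Delta0 k (\<lambda>e. mem (f e) X)"
| D_imp: "Delta0 k P \<Longrightarrow> Delta0 k Q \<Longrightarrow> Delta0 k (\<lambda>e. P e \<longrightarrow> Q e)"
| D_ball_raw: "Delta0 (Suc k) P \<Longrightarrow> term_def k f \<Longrightarrow>
    Delta0 k (\<lambda>e. \<forall>x. x \<prec> f e \<longrightarrow> P (case_nat x e))"

text \<open>The bound variable is an argument apart from the environment, so that the rule unifies
  with quantifiers as they are usually written; the bound \<open>f\<close> sees only the outer
  environment.\<close>

lemma D_ball:
  assumes "Delta0 (Suc k) (\<lambda>e. P (e 0) (\<lambda>i. e (Suc i)))" "term_def k f"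
  shows "Delta0 k (\<lambda>e. \<forall>x. x \<prec> f e \<longrightarrow> P x e)"
  using D_ball_raw[OF assms] by simp

lemma D_not: "Delta0 k P \<Longrightarrow> Delta0 k (\<lambda>e. \<not> P e)"
  using D_imp[OF _ D_False, of k P] by simp

lemma D_const: "Delta0 k (\<lambda>e. b)"
  using D_False[of k] D_not[OF D_False, of k] by (cases b) auto

lemma D_disj: "Delta0 k P \<Longrightarrow> Delta0 k Q \<Longrightarrow> Delta0 k (\<lambda>e. P e \<or> Q e)"
  using D_imp[OF D_not, of k P Q] by (simp add: imp_conv_disj)

lemma D_conj: "Delta0 k P \<Longrightarrow> Delta0 k Q \<Longrightarrow> Delta0 k (\<lambda>e. P e \<and> Q e)"
  using D_not[OF D_imp[OF _ D_not], of k P Q] by simp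

lemma D_iff: "Delta0 k P \<Longrightarrow> Delta0 k Q \<Longrightarrow> Delta0 k (\<lambda>e. P e = Q e)"
  using D_conj[OF D_imp D_imp, of k P Q Q P] by (simp add: iff_conv_conj_imp)

lemma D_bex:
  assumes "Delta0 (Suc k) (\<lambda>e. P (e 0) (\<lambda>i. e (Suc i)))" "term_def k f"
  shows "Delta0 k (\<lambda>e. \<exists>x. x \<prec> f e \<and> P x e)"
  using D_not[OF D_ball[OF D_not[OF assms(1)] assms(2)]] by simp

lemmas D_rules = D_const D_eq D_less D_mem D_not D_disj D_conj D_iff D_imp D_bex D_ball
  term_var term_const term_add term_mul

lemma term_def_subst:
  "term_def k f \<Longrightarrow> (\<And>i. i < k \<Longrightarrow> term_def l (g i)) \<Longrightarrow> term_def l (\<lambda>e. f (\<lambda>i. g i e))"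
  by (induction rule: term_def.induct) (auto intro: term_def.intros)

lemma term_def_Suc: "term_def k f \<Longrightarrow> term_def (Suc k) (\<lambda>e. f (\<lambda>i. e (Suc i)))"
  by (rule term_def_subst) (auto intro: term_var)

text \<open>Bounds are terms and remain terms under substitution, so a predicate known to be bounded
  in its plain arguments can be used at arbitrary terms. This is needed for predicates that are only
  assumed to be bounded.\<close>

lemma Delta0_subst:
  "Delta0 k P \<Longrightarrow> (\<And>i. i < k \<Longrightarrow> term_def l (g i)) \<Longrightarrow> Delta0 l (\<lambda>e. P (\<lambda>i. g i e))"
proof (induction arbitrary: l g rule: Delta0.induct)
  case (D_ball_raw k P f)
  define g' where "g' = case_nat (\<lambda>e. e 0) (\<lambda>i e. g i (\<lambda>j. e (Suc j)))"
  have "term_def (Suc l) (g' i)" if "i < Suc k" for i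
    using that D_ball_raw.prems
    by (auto simp: g'_def intro: term_var term_def_Suc split: nat.split)
  then have "Delta0 (Suc l) (\<lambda>e. P (\<lambda>i. g' i e))" by (rule D_ball_raw.IH)
  moreover have "(\<lambda>i. g' i (case_nat x e)) = case_nat x (\<lambda>i. g i e)" for x e
    by (rule ext) (simp add: g'_def split: nat.split)
  ultimately show ?case
    using Delta0.D_ball_raw[of l "\<lambda>e. P (\<lambda>i. g' i e)" "\<lambda>e. f (\<lambda>i. g i e)"]
      term_def_subst[OF D_ball_raw.hyps(2) D_ball_raw.prems] by simp
next
  case (D_False k)
  show ?case by (rule Delta0.D_False)
next
  case (D_eq k f h)
  show ?case
    by (rule Delta0.D_eq[OF term_def_subst[OF D_eq(1)] term_def_subst[OF D_eq(2)]])
      (rule D_eq.prems, assumption)+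
next
  case (D_less k f h)
  show ?case
    by (rule Delta0.D_less[OF term_def_subst[OF D_less(1)] term_def_subst[OF D_less(2)]])
      (rule D_less.prems, assumption)+
next
  case (D_mem k f X)
  show ?case
    by (rule Delta0.D_mem[OF term_def_subst[OF D_mem(1)]]) (rule D_mem.prems, assumption)
next
  case (D_imp k P Q)
  show ?case
    by (rule Delta0.D_imp[OF D_imp.IH(1) D_imp.IH(2)]) (rule D_imp.prems, assumption)+
qed

lemma D_subst1:
  assumes "Delta0 1 (\<lambda>e. P (e 0))" "term_def k f"
  shows "Delta0 k (\<lambda>e. P (f e))"
  using Delta0_subst[OF assms(1), of k "\<lambda>_. f"] assms(2) by simp

lemma D_subst2:
  assumes "Delta0 2 (\<lambda>e. P (e 0) (e 1))" "term_def k f" "term_def k g"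
  shows "Delta0 k (\<lambda>e. P (f e) (g e))"
  using Delta0_subst[OF assms(1), of k "case_nat f (\<lambda>_. g)"] assms(2,3)
  by (simp split: nat.split)

lemma D_subst3:
  assumes "Delta0 3 (\<lambda>e. P (e 0) (e 1) (e 2))" "term_def k f" "term_def k g" "term_def k h"
  shows "Delta0 k (\<lambda>e. P (f e) (g e) (h e))"
  using Delta0_subst[OF assms(1), of k "case_nat f (case_nat g (\<lambda>_. h))"] assms(2-)
  by (simp split: nat.split add: numeral_2_eq_2)

text \<open>Indices below \<open>k\<close> carry the arguments and the rest enumerate the whole
  domain: the variable \<open>k + to_nat c\<close> names the element \<open>c\<close>, just as the
  set variable \<open>to_nat X\<close> names \<open>X\<close>.\<close>

definition param_env :: "nat \<Rightarrow> (nat \<Rightarrow> 'a) \<Rightarrow> nat \<Rightarrow> 'a" where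
  "param_env k e i = (if i < k then e i else from_nat (i - k))"

lemma param_env_0 [simp]: "param_env 0 e = from_nat"
  by (rule ext) (simp add: param_env_def)

lemma param_env_Suc: "param_env (Suc k) (case_nat x e) = case_nat x (param_env k e)"
  by (rule ext) (simp add: param_env_def split: nat.split)

lemma term_def_teval: "term_def k f \<Longrightarrow> \<exists>t. \<forall>e. f e = teval (param_env k e) t"
proof (induction rule: term_def.induct)
  case (term_var i k)
  then show ?case by (intro exI[of _ "Var i"]) (simp add: param_env_def)
next
  case (term_const k c)
  show ?case by (intro exI[of _ "Var (k + to_nat c)"]) (simp add: param_env_def)
next
  case (term_add k f g)
  then show ?case by (metis teval.simps(4))
next
  case (term_mul k f g)
  then show ?case by (metis teval.simps(5))
qed

lemma Delta0_sat:
  "Delta0 k P \<Longrightarrow> \<exists>p. Delta00 p \<and> (\<forall>e. P e = sat (param_env k e) from_nat p)"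
proof (induction rule: Delta0.induct)
  case (D_False k)
  then show ?case by (intro exI[of _ Bot]) (simp add: Delta00.intros)
next
  case (D_eq k f g)
  then obtain s t where "\<forall>e. f e = teval (param_env k e) s" "\<forall>e. g e = teval (param_env k e) t"
    using term_def_teval by meson
  then show ?case by (intro exI[of _ "s \<^bold>= t"]) (simp add: Delta00.intros)
next
  case (D_less k f g)
  then obtain s t where "\<forall>e. f e = teval (param_env k e) s" "\<forall>e. g e = teval (param_env k e) t"
    using term_def_teval by meson
  then show ?case by (intro exI[of _ "s \<^bold>< t"]) (simp add: Delta00.intros)
next
  case (D_mem k f X)
  then obtain s where "\<forall>e. f e = teval (param_env k e) s"
    using term_def_teval by meson
  then show ?case by (intro exI[of _ "s \<^bold>\<in> to_nat X"]) (simp add: Delta00.intros)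
next
  case (D_imp k P Q)
  then obtain p q where "Delta00 p \<and> (\<forall>e. P e = sat (param_env k e) from_nat p)"
    "Delta00 q \<and> (\<forall>e. Q e = sat (param_env k e) from_nat q)" by blast
  then show ?case by (intro exI[of _ "p \<^bold>\<longrightarrow> q"]) (simp add: Delta00.intros)
next
  case (D_ball_raw k P f)
  then obtain p where "Delta00 p \<and> (\<forall>e. P e = sat (param_env (Suc k) e) from_nat p)" by blast
  moreover obtain t where "\<forall>e. f e = teval (param_env k e) t"
    using term_def_teval D_ball_raw(2) by meson
  ultimately show ?case
    by (intro exI[of _ "NAll (Var 0 \<^bold>< tlift t \<^bold>\<longrightarrow> p)"])
      (simp add: Delta00.intros param_env_Suc)
qed

lemma axiom_sat:
  assumes "p \<in> basic_axioms \<union> {induction_axiom p | p. Sigma01 p} \<union>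
     {comprehension_axiom p q | p q. Sigma01 p \<and> Pi01 q}"
  shows "sat e S p"
proof -
  have "\<exists>n m. (SAll ^^ m) ((NAll ^^ n) p) \<in> RCA0"
    unfolding RCA0_def by (rule universal_closures_exists[OF assms])
  then obtain m n where "(SAll ^^ m) ((NAll ^^ n) p) \<in> RCA0" by blast
  then show ?thesis using sat_closure[OF RCA0_sat] by blast
qed

section \<open>Induction and comprehension inside the model\<close>

lemma Sigma1_induct:
  assumes Q: "Delta0 2 (\<lambda>e. Q (e 0) (e 1))" and zero: "\<exists>w. Q w \<zero>"
    and step: "\<And>n. \<exists>w. Q w n \<Longrightarrow> \<exists>w. Q w (n \<oplus> \<one>)"
  shows "\<exists>w. Q w n"
proof -
  obtain p where p: "Delta00 p" "\<And>e. Q (e 0) (e 1) = sat (param_env 2 e) from_nat p"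
    using Delta0_sat[OF Q] by blast
  have env: "sat (case_nat w (case_nat n from_nat)) from_nat p = Q w n" for w n
    using p(2)[of "case_nat w (case_nat n undefined)"]
    by (simp add: numeral_2_eq_2 param_env_Suc)
  have "sat from_nat from_nat (induction_axiom (NEx p))"
    by (rule axiom_sat) (use p(1) in \<open>auto simp: Sigma01_def\<close>)
  moreover have succ: "sat (case_nat n from_nat) S (succ_inst r) = sat (case_nat (n \<oplus> \<one>) from_nat) S r" for n S r
  proof -
    have "(\<lambda>i. teval (case_nat n from_nat) (case_nat (Var 0 \<^bold>+ One) (\<lambda>i. Var (Suc i)) i)) =
        case_nat (n \<oplus> \<one>) from_nat"
      by (rule ext) (simp split: nat.split)
    then show ?thesis by (simp add: succ_inst_def sat_fsubst)
  qed
  moreover have inst: "sat from_nat S (ninst Zero r) = sat (case_nat \<zero> from_nat) S r" for S r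
  proof -
    have "(\<lambda>i. teval from_nat (case_nat Zero Var i)) = case_nat \<zero> from_nat"
      by (rule ext) (simp split: nat.split)
    then show ?thesis by (simp add: ninst_def sat_fsubst)
  qed
  ultimately have "(\<exists>w. Q w \<zero>) \<and> (\<forall>n. (\<exists>w. Q w n) \<longrightarrow> (\<exists>w. Q w (n \<oplus> \<one>))) \<longrightarrow> (\<forall>n. \<exists>w. Q w n)"
    by (simp only: induction_axiom_def sat.simps succ inst env) blast
  with zero step show ?thesis by blast
qed

lemma Delta0_induct:
  assumes P: "Delta0 1 (\<lambda>e. P (e 0))" and "P \<zero>" "\<And>n. P n \<Longrightarrow> P (n \<oplus> \<one>)"
  shows "P n"
  \<comment> \<open>A bounded formula becomes \<open>Sigma01\<close> by a vacuous existential
    quantifier.\<close>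
  using Sigma1_induct[of "\<lambda>w n. P n" n] D_subst1[OF P term_var, of 1 2] assms(2,3) by auto

lemma Delta1_comprehension:
  assumes A: "Delta0 2 (\<lambda>e. A (e 0) (e 1))" and B: "Delta0 2 (\<lambda>e. B (e 0) (e 1))"
    and AB: "\<And>n. (\<exists>w. A w n) \<longleftrightarrow> (\<forall>w. B w n)"
  shows "\<exists>X. \<forall>n. mem n X \<longleftrightarrow> (\<exists>w. A w n)"
proof -
  obtain p where p: "Delta00 p" "\<And>e. A (e 0) (e 1) = sat (param_env 2 e) from_nat p"
    using Delta0_sat[OF A] by blast
  obtain q where q: "Delta00 q" "\<And>e. B (e 0) (e 1) = sat (param_env 2 e) from_nat q"
    using Delta0_sat[OF B] by blast
  have p': "sat (case_nat w (case_nat n from_nat)) from_nat p = A w n" for w n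
    using p(2)[of "case_nat w (case_nat n undefined)"]
    by (simp add: numeral_2_eq_2 param_env_Suc)
  have q': "sat (case_nat w (case_nat n from_nat)) from_nat q = B w n" for w n
    using q(2)[of "case_nat w (case_nat n undefined)"]
    by (simp add: numeral_2_eq_2 param_env_Suc)
  have "sat from_nat from_nat (comprehension_axiom (NEx p) (NAll q))"
    by (rule axiom_sat) (use p(1) q(1) in \<open>auto simp: Sigma01_def Pi01_def\<close>)
  moreover have "sat e (case_nat X from_nat) (slift r) = sat e from_nat r" for e X r
    by (simp add: slift_def sat_fsubst)
  ultimately have "(\<forall>n. (\<exists>w. A w n) \<longleftrightarrow> (\<forall>w. B w n)) \<longrightarrow> (\<exists>X. \<forall>n. mem n X \<longleftrightarrow> (\<exists>w. A w n))"
    by (simp add: comprehension_axiom_def p' q') blast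
  with AB show ?thesis by blast
qed

lemma Delta0_comprehension:
  assumes P: "Delta0 1 (\<lambda>e. P (e 0))"
  shows "\<exists>X. \<forall>n. mem n X \<longleftrightarrow> P n"
  using Delta1_comprehension[of "\<lambda>w n. P n" "\<lambda>w n. P n"] D_subst1[OF P term_var, of 1 2] by auto

section \<open>Arithmetic\<close>

lemma basic_axiom_sat: "p \<in> basic_axioms \<Longrightarrow> sat e S p"
  by (rule axiom_sat) blast

lemma Suc_neq_zero [simp]: "n \<oplus> \<one> \<noteq> \<zero>" "\<zero> \<noteq> n \<oplus> \<one>"
  using basic_axiom_sat[of "\<^bold>\<not> (Var 0 \<^bold>+ One \<^bold>= Zero)" "\<lambda>_. n"] by (auto simp: basic_axioms_def)

lemma Suc_cancel [simp]: "m \<oplus> \<one> = n \<oplus> \<one> \<longleftrightarrow> m = n"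
  using basic_axiom_sat[of "Var 1 \<^bold>+ One \<^bold>= Var 0 \<^bold>+ One \<^bold>\<longrightarrow> Var 1 \<^bold>= Var 0" "case_nat n (\<lambda>_. m)"]
  by (auto simp: basic_axioms_def)

lemma add_zero [simp]: "n \<oplus> \<zero> = n"
  using basic_axiom_sat[of "Var 0 \<^bold>+ Zero \<^bold>= Var 0" "\<lambda>_. n"] by (auto simp: basic_axioms_def)

lemma add_Suc: "m \<oplus> (n \<oplus> \<one>) = m \<oplus> n \<oplus> \<one>"
  using basic_axiom_sat[of "Var 1 \<^bold>+ (Var 0 \<^bold>+ One) \<^bold>= (Var 1 \<^bold>+ Var 0) \<^bold>+ One" "case_nat n (\<lambda>_. m)"]
  by (auto simp: basic_axioms_def)

lemma mul_zero [simp]: "n \<otimes> \<zero> = \<zero>"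
  using basic_axiom_sat[of "Var 0 \<^bold>* Zero \<^bold>= Zero" "\<lambda>_. n"] by (auto simp: basic_axioms_def)

lemma mul_Suc: "m \<otimes> (n \<oplus> \<one>) = m \<otimes> n \<oplus> m"
  using basic_axiom_sat[of "Var 1 \<^bold>* (Var 0 \<^bold>+ One) \<^bold>= Var 1 \<^bold>* Var 0 \<^bold>+ Var 1" "case_nat n (\<lambda>_. m)"]
  by (auto simp: basic_axioms_def)

lemma not_less_zero [simp]: "\<not> n \<prec> \<zero>"
  using basic_axiom_sat[of "\<^bold>\<not> (Var 0 \<^bold>< Zero)" "\<lambda>_. n"] by (auto simp: basic_axioms_def)

lemma less_Suc: "m \<prec> n \<oplus> \<one> \<longleftrightarrow> m \<prec> n \<or> m = n"
  using basic_axiom_sat[of "Var 1 \<^bold>< Var 0 \<^bold>+ One \<^bold>\<longleftrightarrow> Var 1 \<^bold>< Var 0 \<^bold>\<or> Var 1 \<^bold>= Var 0" "case_nat n (\<lambda>_. m)"]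
  by (auto simp: basic_axioms_def)

lemma zero_add [simp]: "\<zero> \<oplus> n = n"
proof (rule Delta0_induct[of "\<lambda>n. \<zero> \<oplus> n = n"])
  show "Delta0 1 (\<lambda>e. \<zero> \<oplus> e 0 = e 0)" by (intro D_rules) simp_all
qed (simp_all add: add_Suc)

lemma Suc_add: "m \<oplus> \<one> \<oplus> n = m \<oplus> n \<oplus> \<one>"
proof (rule Delta0_induct[of "\<lambda>n. m \<oplus> \<one> \<oplus> n = m \<oplus> n \<oplus> \<one>"])
  show "Delta0 1 (\<lambda>e. m \<oplus> \<one> \<oplus> e 0 = m \<oplus> e 0 \<oplus> \<one>)" by (intro D_rules) simp_all
qed (simp_all add: add_Suc)

lemma add_com: "m \<oplus> n = n \<oplus> m"
proof (rule Delta0_induct[of "\<lambda>n. m \<oplus> n = n \<oplus> m"])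
  show "Delta0 1 (\<lambda>e. m \<oplus> e 0 = e 0 \<oplus> m)" by (intro D_rules) simp_all
qed (simp_all add: add_Suc Suc_add[of _ m])

lemma add_ass: "(l \<oplus> m) \<oplus> n = l \<oplus> (m \<oplus> n)"
proof (rule Delta0_induct[of "\<lambda>n. (l \<oplus> m) \<oplus> n = l \<oplus> (m \<oplus> n)"])
  show "Delta0 1 (\<lambda>e. (l \<oplus> m) \<oplus> e 0 = l \<oplus> (m \<oplus> e 0))" by (intro D_rules) simp_all
qed (simp_all add: add_Suc)

lemma zero_mul [simp]: "\<zero> \<otimes> n = \<zero>"
proof (rule Delta0_induct[of "\<lambda>n. \<zero> \<otimes> n = \<zero>"])
  show "Delta0 1 (\<lambda>e. \<zero> \<otimes> e 0 = \<zero>)" by (intro D_rules) simp_all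
qed (simp_all add: mul_Suc)

lemma Suc_mul: "(m \<oplus> \<one>) \<otimes> n = m \<otimes> n \<oplus> n"
proof (rule Delta0_induct[of "\<lambda>n. (m \<oplus> \<one>) \<otimes> n = m \<otimes> n \<oplus> n"])
  show "Delta0 1 (\<lambda>e. (m \<oplus> \<one>) \<otimes> e 0 = m \<otimes> e 0 \<oplus> e 0)" by (intro D_rules) simp_all
  fix n
  assume "(m \<oplus> \<one>) \<otimes> n = m \<otimes> n \<oplus> n"
  then show "(m \<oplus> \<one>) \<otimes> (n \<oplus> \<one>) = m \<otimes> (n \<oplus> \<one>) \<oplus> (n \<oplus> \<one>)"
    by (simp add: mul_Suc) (metis add_ass add_com)
qed simp

lemma mul_com: "m \<otimes> n = n \<otimes> m"
proof (rule Delta0_induct[of "\<lambda>n. m \<otimes> n = n \<otimes> m"])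
  show "Delta0 1 (\<lambda>e. m \<otimes> e 0 = e 0 \<otimes> m)" by (intro D_rules) simp_all
qed (simp_all add: mul_Suc Suc_mul)

lemma mul_add: "l \<otimes> (m \<oplus> n) = l \<otimes> m \<oplus> l \<otimes> n"
proof (rule Delta0_induct[of "\<lambda>n. l \<otimes> (m \<oplus> n) = l \<otimes> m \<oplus> l \<otimes> n"])
  show "Delta0 1 (\<lambda>e. l \<otimes> (m \<oplus> e 0) = l \<otimes> m \<oplus> l \<otimes> e 0)" by (intro D_rules) simp_all
  fix n
  assume "l \<otimes> (m \<oplus> n) = l \<otimes> m \<oplus> l \<otimes> n"
  then show "l \<otimes> (m \<oplus> (n \<oplus> \<one>)) = l \<otimes> m \<oplus> l \<otimes> (n \<oplus> \<one>)"
    by (simp add: mul_Suc add_ass flip: add_Suc) (metis add_ass mul_Suc)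
qed simp

lemma one_mul [simp]: "\<one> \<otimes> n = n"
  using Suc_mul[of \<zero> n] by simp

lemma mul_one [simp]: "n \<otimes> \<one> = n"
  using mul_Suc[of n \<zero>] by simp

lemma mul_ass: "(l \<otimes> m) \<otimes> n = l \<otimes> (m \<otimes> n)"
proof (rule Delta0_induct[of "\<lambda>n. (l \<otimes> m) \<otimes> n = l \<otimes> (m \<otimes> n)"])
  show "Delta0 1 (\<lambda>e. (l \<otimes> m) \<otimes> e 0 = l \<otimes> (m \<otimes> e 0))" by (intro D_rules) simp_all
qed (simp_all add: mul_Suc mul_add)

lemma add_cancel: "m \<oplus> k = n \<oplus> k \<Longrightarrow> m = n"
proof -
  have "m \<oplus> k = n \<oplus> k \<longrightarrow> m = n"
  proof (rule Delta0_induct[of "\<lambda>k. m \<oplus> k = n \<oplus> k \<longrightarrow> m = n"])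
    show "Delta0 1 (\<lambda>e. m \<oplus> e 0 = n \<oplus> e 0 \<longrightarrow> m = n)" by (intro D_rules) simp_all
  qed (simp_all add: add_Suc)
  then show "m \<oplus> k = n \<oplus> k \<Longrightarrow> m = n" by blast
qed

text \<open>The bound on the predecessor in the proof makes the induction formula a bounded one, as
  \<open>Delta0_induct\<close> demands. The same device bounds the difference in
  \<open>less_iff_Suc\<close>.\<close>

lemma zero_or_Suc: "n = \<zero> \<or> (\<exists>m. n = m \<oplus> \<one>)"
proof -
  have "n = \<zero> \<or> (\<exists>m. m \<prec> n \<and> n = m \<oplus> \<one>)"
  proof (rule Delta0_induct[of "\<lambda>n. n = \<zero> \<or> (\<exists>m. m \<prec> n \<and> n = m \<oplus> \<one>)"])
    show "Delta0 1 (\<lambda>e. e 0 = \<zero> \<or> (\<exists>m. m \<prec> e 0 \<and> e 0 = m \<oplus> \<one>))"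
      by (intro D_rules) simp_all
  qed (auto simp: less_Suc)
  then show ?thesis by blast
qed

lemma less_add_Suc: "m \<prec> m \<oplus> k \<oplus> \<one>"
proof (rule Delta0_induct[of "\<lambda>k. m \<prec> m \<oplus> k \<oplus> \<one>"])
  show "Delta0 1 (\<lambda>e. m \<prec> m \<oplus> e 0 \<oplus> \<one>)" by (intro D_rules) simp_all
  fix n
  assume "m \<prec> m \<oplus> n \<oplus> \<one>"
  then show "m \<prec> m \<oplus> (n \<oplus> \<one>) \<oplus> \<one>"
    by (simp add: less_Suc add_Suc)
qed (simp add: less_Suc)

lemma less_iff_Suc: "m \<prec> n \<longleftrightarrow> (\<exists>k. n = m \<oplus> k \<oplus> \<one>)"
proof -
  have "m \<prec> n \<longrightarrow> (\<exists>k. k \<prec> n \<and> n = m \<oplus> k \<oplus> \<one>)"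
  proof (rule Delta0_induct[of "\<lambda>n. m \<prec> n \<longrightarrow> (\<exists>k. k \<prec> n \<and> n = m \<oplus> k \<oplus> \<one>)"])
    show "Delta0 1 (\<lambda>e. m \<prec> e 0 \<longrightarrow> (\<exists>k. k \<prec> e 0 \<and> e 0 = m \<oplus> k \<oplus> \<one>))"
      by (intro D_rules) simp_all
    fix n
    assume IH: "m \<prec> n \<longrightarrow> (\<exists>k. k \<prec> n \<and> n = m \<oplus> k \<oplus> \<one>)"
    show "m \<prec> n \<oplus> \<one> \<longrightarrow> (\<exists>k. k \<prec> n \<oplus> \<one> \<and> n \<oplus> \<one> = m \<oplus> k \<oplus> \<one>)"
    proof
      assume "m \<prec> n \<oplus> \<one>"
      then consider "m = n" | "m \<prec> n" using less_Suc by blast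
      then show "\<exists>k. k \<prec> n \<oplus> \<one> \<and> n \<oplus> \<one> = m \<oplus> k \<oplus> \<one>"
      proof cases
        case 1
        have "\<zero> \<prec> n \<oplus> \<one>" using less_add_Suc[of \<zero> n] by simp
        with 1 show ?thesis by (intro exI[of _ \<zero>]) simp
      next
        case 2
        then obtain k where "k \<prec> n" "n = m \<oplus> k \<oplus> \<one>" using IH by blast
        moreover from this have "n \<oplus> \<one> = k \<oplus> \<one> \<oplus> m \<oplus> \<one>"
          by (simp add: Suc_add[of k m] add_com[of k m])
        then have "k \<oplus> \<one> \<prec> n \<oplus> \<one>"
          using less_add_Suc[of "k \<oplus> \<one>" m] by simp
        ultimately show ?thesis
          by (intro exI[of _ "k \<oplus> \<one>"]) (simp add: add_Suc)
      qed
    qed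
  qed simp
  then show ?thesis using less_add_Suc by blast
qed

lemma less_linear': "m \<prec> n \<or> m = n \<or> n \<prec> m"
proof (rule Delta0_induct[of "\<lambda>m. m \<prec> n \<or> m = n \<or> n \<prec> m"])
  show "Delta0 1 (\<lambda>e. e 0 \<prec> n \<or> e 0 = n \<or> n \<prec> e 0)" by (intro D_rules) simp_all
  show "\<zero> \<prec> n \<or> \<zero> = n \<or> n \<prec> \<zero>"
    using zero_or_Suc[of n] less_add_Suc[of \<zero>] by auto
  fix m
  assume IH: "m \<prec> n \<or> m = n \<or> n \<prec> m"
  show "m \<oplus> \<one> \<prec> n \<or> m \<oplus> \<one> = n \<or> n \<prec> m \<oplus> \<one>"
  proof (cases "m \<prec> n")
    case True
    then obtain k where k: "n = m \<oplus> k \<oplus> \<one>" using less_iff_Suc by blast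
    show ?thesis
    proof (cases "k = \<zero>")
      case False
      then obtain l where "k = l \<oplus> \<one>" using zero_or_Suc by blast
      then have "n = m \<oplus> \<one> \<oplus> l \<oplus> \<one>" using k by (simp add: add_Suc Suc_add[of m l])
      then show ?thesis using less_iff_Suc by blast
    qed (use k in simp)
  qed (use IH less_Suc in blast)
qed

definition le (infix "\<preceq>" 50) where
  "m \<preceq> n \<longleftrightarrow> m \<prec> n \<or> m = n"

text \<open>Truncated subtraction, which \<open>linordered_semidom\<close> asks for although the
  language has no symbol for it.\<close>

definition minus (infixl "\<ominus>" 65) where
  "m \<ominus> n = (if n \<preceq> m then THE k. m = n \<oplus> k else \<zero>)"

lemma le_iff_add: "m \<preceq> n \<longleftrightarrow> (\<exists>k. n = m \<oplus> k)"
  unfolding le_def less_iff_Suc using zero_or_Suc by (metis add_Suc add_zero)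

lemma not_less_self [simp]: "\<not> n \<prec> n"
  by (metis Suc_neq_zero(1) add_Suc add_cancel add_com less_iff_Suc zero_add)

lemma less_trans': "l \<prec> m \<Longrightarrow> m \<prec> n \<Longrightarrow> l \<prec> n"
  unfolding less_iff_Suc by (metis add_Suc add_ass)

lemma add_minus: "(m \<oplus> n) \<ominus> m = n"
proof -
  have "(THE k. m \<oplus> n = m \<oplus> k) = n"
    by (rule the_equality) (metis add_cancel add_com)+
  moreover have "m \<preceq> m \<oplus> n" using le_iff_add by blast
  ultimately show ?thesis by (simp add: minus_def)
qed

lemma mul_eq_zero: "m \<otimes> n = \<zero> \<longleftrightarrow> m = \<zero> \<or> n = \<zero>"
proof -
  have "m \<otimes> n \<noteq> \<zero>" if "m = k \<oplus> \<one>" "n = l \<oplus> \<one>" for k l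
    using that by (simp add: mul_Suc add_Suc)
  then show ?thesis using zero_or_Suc[of m] zero_or_Suc[of n] by auto
qed

text \<open>This opens the library's theory of order and divisibility to the possibly nonstandard
  numbers of the model; the coding of finite sets rests on it.\<close>

sublocale A: linordered_semidom
  where zero = zero and one = one and plus = add and times = mul and less = less
    and less_eq = le and minus = minus
proof
  fix a b c
  show "a \<oplus> b \<oplus> c = a \<oplus> (b \<oplus> c)" by (rule add_ass)
  show "a \<oplus> b = b \<oplus> a" by (rule add_com)
  show "a \<otimes> b \<otimes> c = a \<otimes> (b \<otimes> c)" by (rule mul_ass)
  show "a \<otimes> b = b \<otimes> a" by (rule mul_com)
  show "a \<oplus> b \<ominus> a = b" by (rule add_minus)
  show le_minus: "a \<ominus> b \<oplus> b = a" if "b \<preceq> a" for a b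
    using that add_minus le_iff_add add_com by metis
  show "a \<prec> b \<longleftrightarrow> a \<preceq> b \<and> \<not> b \<preceq> a"
    unfolding le_def using less_trans' not_less_self by blast
  show "a \<preceq> a" by (simp add: le_def)
  show "a \<preceq> b \<Longrightarrow> b \<preceq> c \<Longrightarrow> a \<preceq> c"
    unfolding le_def using less_trans' by blast
  show "a \<preceq> b \<Longrightarrow> b \<preceq> a \<Longrightarrow> a = b"
    unfolding le_def using less_trans' not_less_self by blast
  show "a \<preceq> b \<Longrightarrow> c \<oplus> a \<preceq> c \<oplus> b"
    unfolding le_iff_add using add_ass by metis
  show "a \<preceq> b \<or> b \<preceq> a"
    unfolding le_def using less_linear' by blast
  show "a \<ominus> b \<ominus> c = a \<ominus> (b \<oplus> c)"
  proof (cases "b \<oplus> c \<preceq> a")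
    case True
    then obtain k where "a = b \<oplus> c \<oplus> k" using le_iff_add by blast
    then show ?thesis using add_minus add_ass by metis
  next
    case False
    have "\<not> c \<preceq> a \<ominus> b" if "b \<preceq> a"
    proof
      assume "c \<preceq> a \<ominus> b"
      then obtain k where "a \<ominus> b = c \<oplus> k" using le_iff_add by blast
      then have "a = b \<oplus> c \<oplus> k" using le_minus[OF that] add_ass add_com by metis
      with False show False using le_iff_add by blast
    qed
    moreover have "\<zero> \<ominus> c = \<zero>"
      using add_minus[of \<zero> \<zero>] by (auto simp: minus_def le_def)
    ultimately show ?thesis using False by (auto simp: minus_def)
  qed
  show "a \<otimes> (b \<oplus> c) = a \<otimes> b \<oplus> a \<otimes> c" by (rule mul_add)
  show "a \<otimes> (b \<ominus> c) = a \<otimes> b \<ominus> a \<otimes> c"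
  proof (cases "c \<preceq> b")
    case True
    then obtain k where "b = c \<oplus> k" using le_iff_add by blast
    then show ?thesis by (simp add: mul_add add_minus)
  next
    case False
    then obtain k where k: "c = b \<oplus> k"
      using less_linear' le_def le_iff_add by metis
    have "m \<ominus> (m \<oplus> l) = \<zero>" for m l
    proof (cases "m \<oplus> l \<preceq> m")
      case True
      then have "m \<oplus> l = m"
        unfolding le_def using le_iff_add[of m "m \<oplus> l"] less_trans' not_less_self le_def by metis
      then show ?thesis using add_minus[of m \<zero>] by simp
    qed (simp add: minus_def)
    then show ?thesis by (simp add: k mul_add)
  qed
  show "\<zero> \<oplus> a = a" by simp
  show "(a \<oplus> b) \<otimes> c = a \<otimes> c \<oplus> b \<otimes> c" using mul_add mul_com by metis
  show "\<zero> \<prec> \<one>" using less_add_Suc[of \<zero> \<zero>] by simp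
  show "\<zero> \<noteq> \<one>" using Suc_neq_zero(2)[of \<zero>] by simp
  show "a \<noteq> \<zero> \<Longrightarrow> b \<noteq> \<zero> \<Longrightarrow> a \<otimes> b \<noteq> \<zero>" by (simp add: mul_eq_zero)
  show "c \<otimes> a \<prec> c \<otimes> b" if ab: "a \<prec> b" and c: "\<zero> \<prec> c"
  proof -
    obtain k where "b = a \<oplus> k \<oplus> \<one>" using ab[unfolded less_iff_Suc] by blast
    then have k: "b = a \<oplus> (k \<oplus> \<one>)" by (simp add: add_Suc)
    obtain l where l: "c = l \<oplus> \<one>" using c not_less_self zero_or_Suc[of c] by blast
    have "c \<otimes> b = c \<otimes> a \<oplus> (c \<otimes> k \<oplus> c)" by (simp add: k mul_add)
    then have "c \<otimes> b = c \<otimes> a \<oplus> (c \<otimes> k \<oplus> l) \<oplus> \<one>" by (metis add_ass l)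
    then show ?thesis unfolding less_iff_Suc by blast
  qed
qed simp_all

lemma zero_le [simp]: "\<zero> \<preceq> n"
  by (simp add: le_iff_add)

lemma less_Suc_le: "m \<prec> n \<oplus> \<one> \<longleftrightarrow> m \<preceq> n"
  by (simp add: less_Suc le_def)

lemma Suc_le: "m \<oplus> \<one> \<preceq> n \<longleftrightarrow> m \<prec> n"
  using A.not_less less_Suc_le by metis

lemma neq_zero: "n \<noteq> \<zero> \<longleftrightarrow> \<zero> \<prec> n"
  using zero_le[of n] by (auto simp: le_def)

lemma Delta0_less_induct:
  assumes P: "Delta0 1 (\<lambda>e. P (e 0))" and step: "\<And>n. (\<And>m. m \<prec> n \<Longrightarrow> P m) \<Longrightarrow> P n"
  shows "P n"
proof -
  have "\<forall>m. m \<prec> n \<longrightarrow> P m"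
  proof (rule Delta0_induct[of "\<lambda>n. \<forall>m. m \<prec> n \<longrightarrow> P m"])
    show "Delta0 1 (\<lambda>e. \<forall>m. m \<prec> e 0 \<longrightarrow> P m)"
      by (intro D_ball term_var D_subst1[OF P]) simp_all
  qed (use step in \<open>auto simp: less_Suc\<close>)
  then show ?thesis using step by blast
qed

section \<open>Pairing\<close>

definition code :: "'a \<Rightarrow> 'a \<Rightarrow> 'a" where
  "code x y = (x \<oplus> y) \<otimes> (x \<oplus> y) \<oplus> x"

lemma term_code: "term_def k f \<Longrightarrow> term_def k g \<Longrightarrow> term_def k (\<lambda>e. code (f e) (g e))"
  unfolding code_def by (intro term_add term_mul)

lemma teval_pair [simp]: "teval e (pair s t) = code (teval e s) (teval e t)"
  by (simp add: pair_def code_def)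

text \<open>With \<open>s = x \<oplus> y\<close> the offset \<open>x\<close> is at most
  \<open>s\<close>, and the square of \<open>s\<close> plus \<open>s\<close> stays below the square
  of \<open>s \<oplus> \<one>\<close>. Codes are thus ordered by the sum first, and recursion on
  codes may call any pair of smaller sum.\<close>

lemma code_less: "x \<oplus> y \<prec> x' \<oplus> y' \<Longrightarrow> code x y \<prec> code x' y'"
proof -
  assume *: "x \<oplus> y \<prec> x' \<oplus> y'"
  define s where "s = x \<oplus> y"
  define s' where "s' = x' \<oplus> y'"
  have "x \<preceq> s" unfolding s_def le_iff_add by blast
  then have "code x y \<preceq> s \<otimes> s \<oplus> s"
    unfolding code_def s_def[symmetric] by (rule A.add_left_mono)
  also have "\<dots> \<prec> s \<otimes> s \<oplus> s \<oplus> s \<oplus> \<one>"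
    by (rule less_add_Suc)
  also have "\<dots> = (s \<oplus> \<one>) \<otimes> (s \<oplus> \<one>)"
    by (simp add: mul_add Suc_mul add_ass)
  also have "\<dots> \<preceq> s' \<otimes> s'"
    using * by (intro A.mult_mono) (simp_all add: Suc_le s_def s'_def)
  also have "\<dots> \<preceq> code x' y'"
    unfolding code_def s'_def le_iff_add by blast
  finally show ?thesis .
qed

lemma code_inject [simp]: "code x y = code x' y' \<longleftrightarrow> x = x' \<and> y = y'"
proof
  assume *: "code x y = code x' y'"
  then have s: "x \<oplus> y = x' \<oplus> y'"
    using code_less not_less_self less_linear' by metis
  then have "x = x'"
    using * unfolding code_def by (metis add_cancel add_com)
  then show "x = x' \<and> y = y'"
    using s by (metis add_cancel add_com)
qed auto

lemma le_code: "x \<preceq> code x y" "y \<preceq> code x y"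
proof -
  show "x \<preceq> code x y" unfolding code_def le_iff_add using add_com by blast
  have "s \<preceq> s \<otimes> s" for s
    using zero_or_Suc[of s] A.mult_right_mono[of \<one> s s]
    by (metis A.mult_1 A.order_refl Suc_le mul_zero neq_zero zero_add zero_le)
  then have "x \<oplus> y \<preceq> code x y"
    unfolding code_def le_iff_add using add_ass by metis
  moreover have "y \<preceq> x \<oplus> y" unfolding le_iff_add using add_com by blast
  ultimately show "y \<preceq> code x y" by (rule A.order_trans[rotated])
qed

lemma less_Suc_code: "x \<prec> code x y \<oplus> \<one>" "y \<prec> code x y \<oplus> \<one>"
  using le_code by (simp_all add: less_Suc_le)

section \<open>Coded finite sets and course-of-values recursion\<close>

text \<open>For a nonzero divisor the quotient is at most \<open>a\<close>, and for
  \<open>d = \<zero>\<close> the quotient \<open>\<zero>\<close> does. Divisibility is therefore a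
  bounded formula.\<close>

lemma dvd_bounded: "A.dvd d a \<longleftrightarrow> (\<exists>q. q \<prec> a \<oplus> \<one> \<and> a = d \<otimes> q)"
proof
  assume "A.dvd d a"
  then obtain q where q: "a = d \<otimes> q" by (rule A.dvdE)
  show "\<exists>q. q \<prec> a \<oplus> \<one> \<and> a = d \<otimes> q"
  proof (cases "d = \<zero>")
    case True
    then show ?thesis using q by (intro exI[of _ \<zero>]) (simp add: less_Suc_le)
  next
    case False
    then have "\<one> \<otimes> q \<preceq> d \<otimes> q"
      by (intro A.mult_right_mono) (metis Suc_le neq_zero zero_add, simp)
    then show ?thesis using q by (intro exI[of _ q]) (simp add: less_Suc_le)
  qed
qed (auto intro: A.dvdI)

lemma D_dvd: "term_def k f \<Longrightarrow> term_def k g \<Longrightarrow> Delta0 k (\<lambda>e. A.dvd (f e) (g e))"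
  unfolding dvd_bounded
  by (intro D_rules) (simp_all add: term_def_Suc)

definition modulus :: "'a \<Rightarrow> 'a \<Rightarrow> 'a" where
  "modulus i b = \<one> \<oplus> (i \<oplus> \<one>) \<otimes> b"

text \<open>Goedel's beta function, with sets instead of sequences as coded objects.\<close>

definition bit :: "'a \<Rightarrow> 'a \<Rightarrow> 'a \<Rightarrow> bool" where
  "bit i a b \<longleftrightarrow> A.dvd (modulus i b) a"

lemma D_bit:
  "term_def k f \<Longrightarrow> term_def k g \<Longrightarrow> term_def k h \<Longrightarrow> Delta0 k (\<lambda>e. bit (f e) (g e) (h e))"
  unfolding bit_def modulus_def by (intro D_dvd term_add term_mul term_const)

text \<open>Coprimality of two moduli, put as a cancellation law. They differ by
  \<open>k \<otimes> b\<close>, so the modulus divides \<open>a \<otimes> k \<otimes> b\<close>. The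
  factor \<open>b\<close> cancels because the modulus is one plus a multiple of \<open>b\<close>.
  The remaining \<open>k\<close> is completed to \<open>b\<close> by the factor \<open>c\<close>,
  and \<open>b\<close> is cancelled once more.\<close>

lemma modulus_dvd_cancel:
  assumes b: "b = k \<otimes> c" and ij: "j = i \<oplus> k \<or> i = j \<oplus> k"
    and dvd: "A.dvd (modulus i b) (a \<otimes> modulus j b)"
  shows "A.dvd (modulus i b) a"
proof -
  have cancel: "A.dvd (modulus i b) x" if "A.dvd (modulus i b) (x \<otimes> b)" for x
  proof -
    have "x \<otimes> (y \<otimes> b) = (x \<otimes> b) \<otimes> y" for y
      by (simp add: mul_ass mul_com[of b])
    then have "x \<otimes> modulus i b = x \<oplus> (x \<otimes> b) \<otimes> (i \<oplus> \<one>)"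
      by (simp only: modulus_def mul_add[of x \<one>] mul_one)
    moreover have "A.dvd (modulus i b) (x \<otimes> modulus i b)" by (rule A.dvd_triv_right)
    ultimately show ?thesis
      using A.dvd_add_left_iff[of "modulus i b" "(x \<otimes> b) \<otimes> (i \<oplus> \<one>)" x] A.dvd_mult2[OF that]
      by simp
  qed
  have "A.dvd (modulus i b) ((a \<otimes> k) \<otimes> b)"
    using ij
  proof
    assume "j = i \<oplus> k"
    then have "modulus j b = modulus i b \<oplus> k \<otimes> b"
      by (simp add: modulus_def A.distrib_right A.add_ac)
    then have "a \<otimes> modulus j b = a \<otimes> modulus i b \<oplus> (a \<otimes> k) \<otimes> b"
      by (simp add: mul_add mul_ass)
    then show ?thesis
      using dvd A.dvd_add_right_iff[of "modulus i b" "a \<otimes> modulus i b"] by simp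
  next
    assume "i = j \<oplus> k"
    then have "modulus i b = modulus j b \<oplus> k \<otimes> b"
      by (simp add: modulus_def A.distrib_right A.add_ac)
    then have "a \<otimes> modulus i b = a \<otimes> modulus j b \<oplus> (a \<otimes> k) \<otimes> b"
      by (simp add: mul_add mul_ass)
    then show ?thesis
      using dvd A.dvd_add_right_iff[of "modulus i b" "a \<otimes> modulus j b"]
        A.dvd_triv_right[of "modulus i b" a] by metis
  qed
  then have "A.dvd (modulus i b) (a \<otimes> k)" by (rule cancel)
  then have "A.dvd (modulus i b) ((a \<otimes> k) \<otimes> c)" by (rule A.dvd_mult2)
  then have "A.dvd (modulus i b) (a \<otimes> b)" unfolding b mul_ass .
  then show ?thesis by (rule cancel)
qed

text \<open>A substitute for the factorial of \<open>n\<close>, whose existence is proved by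
  induction since no recursion is available yet.\<close>

lemma common_multiple:
  "\<exists>b. b \<noteq> \<zero> \<and> (\<forall>k. k \<prec> n \<oplus> \<one> \<longrightarrow> k \<noteq> \<zero> \<longrightarrow> A.dvd k b)"
proof (rule Sigma1_induct[of "\<lambda>b n. b \<noteq> \<zero> \<and> (\<forall>k. k \<prec> n \<oplus> \<one> \<longrightarrow> k \<noteq> \<zero> \<longrightarrow> A.dvd k b)"])
  show "Delta0 2 (\<lambda>e. e 0 \<noteq> \<zero> \<and> (\<forall>k. k \<prec> e 1 \<oplus> \<one> \<longrightarrow> k \<noteq> \<zero> \<longrightarrow> A.dvd k (e 0)))"
    by (intro D_rules D_dvd) simp_all
  show "\<exists>b. b \<noteq> \<zero> \<and> (\<forall>k. k \<prec> \<zero> \<oplus> \<one> \<longrightarrow> k \<noteq> \<zero> \<longrightarrow> A.dvd k b)"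
    by (intro exI[of _ \<one>]) (auto simp: less_Suc simp del: zero_add)
  fix n
  assume "\<exists>b. b \<noteq> \<zero> \<and> (\<forall>k. k \<prec> n \<oplus> \<one> \<longrightarrow> k \<noteq> \<zero> \<longrightarrow> A.dvd k b)"
  then obtain b where "b \<noteq> \<zero>" "\<And>k. k \<prec> n \<oplus> \<one> \<Longrightarrow> k \<noteq> \<zero> \<Longrightarrow> A.dvd k b" by blast
  then show "\<exists>b. b \<noteq> \<zero> \<and> (\<forall>k. k \<prec> n \<oplus> \<one> \<oplus> \<one> \<longrightarrow> k \<noteq> \<zero> \<longrightarrow> A.dvd k b)"
    by (intro exI[of _ "b \<otimes> (n \<oplus> \<one>)"])
      (auto simp: less_Suc[of _ "n \<oplus> \<one>"] mul_eq_zero intro: A.dvd_mult2)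
qed

text \<open>A bit is set by multiplying \<open>a\<close> with its modulus, and by coprimality no
  other bit below \<open>N\<close> changes. Since \<open>b\<close> is fixed for \<open>N\<close>
  beforehand, the induction asserts only the existence of \<open>a\<close>.\<close>

lemma recursion_code_exists:
  assumes \<Phi>: "Delta0 3 (\<lambda>e. \<Phi> (e 0) (\<lambda>j. bit j (e 1) (e 2)))"
    and local: "\<And>n A B. (\<And>j. j \<prec> n \<Longrightarrow> A j = B j) \<Longrightarrow> \<Phi> n A = \<Phi> n B"
  shows "\<exists>a b. \<forall>i. i \<prec> N \<longrightarrow> bit i a b = \<Phi> i (\<lambda>j. bit j a b)"
proof -
  obtain b where b0: "b \<noteq> \<zero>" and b: "\<And>k. k \<prec> N \<oplus> \<one> \<Longrightarrow> k \<noteq> \<zero> \<Longrightarrow> A.dvd k b"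
    using common_multiple by blast
  have cancel: "bit i (a \<otimes> modulus j b) b \<longleftrightarrow> bit i a b" if "i \<prec> N" "j \<prec> N" "i \<noteq> j" for i j a
  proof -
    \<comment> \<open>The difference of two indices below \<open>N\<close> is nonzero and at most
      \<open>N\<close>, hence a divisor of \<open>b\<close>.\<close>
    have "\<exists>k. k \<noteq> \<zero> \<and> k \<prec> N \<oplus> \<one> \<and> (j = i \<oplus> k \<or> i = j \<oplus> k)"
    proof -
      have *: "\<exists>k. k \<noteq> \<zero> \<and> k \<prec> N \<oplus> \<one> \<and> n = m \<oplus> k" if "m \<prec> n" "n \<prec> N" for m n
      proof -
        obtain k where k: "n = m \<oplus> k" using \<open>m \<prec> n\<close> le_iff_add le_def by blast
        then have "k \<preceq> n" using le_iff_add add_com by blast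
        then have "k \<prec> N \<oplus> \<one>" using \<open>n \<prec> N\<close> by (simp add: less_Suc_le)
        moreover have "k \<noteq> \<zero>" using k \<open>m \<prec> n\<close> by auto
        ultimately show ?thesis using k by blast
      qed
      show ?thesis using *[of i j] *[of j i] \<open>i \<prec> N\<close> \<open>j \<prec> N\<close> \<open>i \<noteq> j\<close> less_linear' by blast
    qed
    then obtain k where "k \<noteq> \<zero>" "k \<prec> N \<oplus> \<one>" and ij: "j = i \<oplus> k \<or> i = j \<oplus> k" by blast
    then obtain c where "b = k \<otimes> c" using b by (meson A.dvdE)
    then show ?thesis
      unfolding bit_def using modulus_dvd_cancel[OF _ ij] A.dvd_mult2 by blast
  qed
  \<comment> \<open>The construction starts from \<open>a = \<one>\<close>: as \<open>b\<close> is
    nonzero, all moduli exceed one and no bit is set.\<close>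
  have no_bit: "\<not> bit i \<one> b" for i
  proof
    assume "bit i \<one> b"
    then obtain q where q: "\<one> = modulus i b \<otimes> q" unfolding bit_def by (rule A.dvdE)
    then have "q \<noteq> \<zero>" using Suc_neq_zero(2)[of \<zero>] by auto
    then have "modulus i b \<otimes> \<one> \<preceq> modulus i b \<otimes> q"
      by (intro A.mult_left_mono) (metis Suc_le neq_zero zero_add, simp)
    moreover have "\<one> \<prec> modulus i b"
    proof -
      have "(i \<oplus> \<one>) \<otimes> b \<noteq> \<zero>" using b0 by (simp add: mul_eq_zero)
      then have "\<zero> \<prec> (i \<oplus> \<one>) \<otimes> b" using neq_zero by blast
      then show ?thesis
        unfolding modulus_def using A.add_strict_left_mono[of \<zero> "(i \<oplus> \<one>) \<otimes> b" \<one>] by simp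
    qed
    ultimately show False using q A.not_less by simp
  qed
  \<comment> \<open>Multiplication can set bits but never clear them, so the invariant also keeps
    the bits from \<open>n\<close> up to \<open>N\<close> unset.\<close>
  have "\<exists>a. n \<preceq> N \<longrightarrow> (\<forall>i. i \<prec> N \<longrightarrow> bit i a b = (i \<prec> n \<and> \<Phi> i (\<lambda>j. bit j a b)))" for n
  proof (rule Sigma1_induct[of
      "\<lambda>a n. n \<preceq> N \<longrightarrow> (\<forall>i. i \<prec> N \<longrightarrow> bit i a b = (i \<prec> n \<and> \<Phi> i (\<lambda>j. bit j a b)))"])
    show "Delta0 2 (\<lambda>e. e 1 \<preceq> N \<longrightarrow>
        (\<forall>i. i \<prec> N \<longrightarrow> bit i (e 0) b = (i \<prec> e 1 \<and> \<Phi> i (\<lambda>j. bit j (e 0) b))))"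
      unfolding le_def
      by (intro D_disj D_less D_eq D_imp D_ball D_iff D_conj D_bit D_subst3[OF \<Phi>]
          term_var term_const) simp_all
    show "\<exists>a. \<zero> \<preceq> N \<longrightarrow> (\<forall>i. i \<prec> N \<longrightarrow> bit i a b = (i \<prec> \<zero> \<and> \<Phi> i (\<lambda>j. bit j a b)))"
      using no_bit by (intro exI[of _ \<one>]) simp
    fix n
    assume "\<exists>a. n \<preceq> N \<longrightarrow> (\<forall>i. i \<prec> N \<longrightarrow> bit i a b = (i \<prec> n \<and> \<Phi> i (\<lambda>j. bit j a b)))"
    then obtain a where
      a: "n \<preceq> N \<longrightarrow> (\<forall>i. i \<prec> N \<longrightarrow> bit i a b = (i \<prec> n \<and> \<Phi> i (\<lambda>j. bit j a b)))" by blast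
    show "\<exists>a. n \<oplus> \<one> \<preceq> N \<longrightarrow>
        (\<forall>i. i \<prec> N \<longrightarrow> bit i a b = (i \<prec> n \<oplus> \<one> \<and> \<Phi> i (\<lambda>j. bit j a b)))"
    proof (cases "n \<prec> N")
      case False
      then show ?thesis by (simp add: Suc_le)
    next
      case True
      then have a: "\<And>i. i \<prec> N \<Longrightarrow> bit i a b = (i \<prec> n \<and> \<Phi> i (\<lambda>j. bit j a b))"
        using a le_def by blast
      show ?thesis
      proof (cases "\<Phi> n (\<lambda>j. bit j a b)")
        case False
        then show ?thesis using a by (intro exI[of _ a]) (auto simp: less_Suc)
      next
        case P: True
        let ?a = "a \<otimes> modulus n b"
        have eq: "\<Phi> i (\<lambda>j. bit j ?a b) = \<Phi> i (\<lambda>j. bit j a b)" if "i \<preceq> n" for i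
        proof (rule local)
          fix j
          assume "j \<prec> i"
          then have "j \<prec> n" using that A.less_le_trans by blast
          moreover from this have "j \<prec> N" using True less_trans' by blast
          ultimately show "bit j ?a b = bit j a b"
            using cancel[of j n a] True not_less_self by metis
        qed
        have n: "bit n ?a b" unfolding bit_def by (rule A.dvd_triv_right)
        have "bit i ?a b = (i \<prec> n \<oplus> \<one> \<and> \<Phi> i (\<lambda>j. bit j ?a b))" if "i \<prec> N" for i
        proof (cases "i = n")
          case i: True
          have "i \<prec> n \<oplus> \<one>" unfolding less_Suc i by simp
          moreover have "\<Phi> i (\<lambda>j. bit j ?a b)" using eq[of n] P i by simp
          ultimately show ?thesis using n i by simp
        next
          case False
          have "bit i ?a b = (i \<prec> n \<and> \<Phi> i (\<lambda>j. bit j a b))"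
            using cancel[OF that True False, of a] a[OF that] by simp
          then show ?thesis using eq[of i] False by (auto simp: less_Suc le_def)
        qed
        then show ?thesis by blast
      qed
    qed
  qed
  from this[of N] show ?thesis by auto
qed

text \<open>
  The recursion is \<open>\<Delta>\<^sup>0\<^sub>1\<close> because the initial segments, on which \<open>\<Phi>\<close> depends, are coded by numbers.
\<close>

lemma recursive_set:
  assumes \<Phi>: "Delta0 3 (\<lambda>e. \<Phi> (e 0) (\<lambda>j. bit j (e 1) (e 2)))"
    and local: "\<And>n A B. (\<And>j. j \<prec> n \<Longrightarrow> A j = B j) \<Longrightarrow> \<Phi> n A = \<Phi> n B"
  shows "\<exists>X. \<forall>n. mem n X = \<Phi> n (\<lambda>j. mem j X)"
proof -
  define correct where
    "correct n a b \<longleftrightarrow> (\<forall>i. i \<prec> n \<longrightarrow> bit i a b = \<Phi> i (\<lambda>j. bit j a b))" for n a b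
  have exists: "\<exists>a b. correct n a b" for n
    unfolding correct_def by (rule recursion_code_exists[OF \<Phi> local])
  \<comment> \<open>Codes that obey the recursion agree wherever both do. Hence asking for some
    correct code or for all of them gives the same answer, which is what comprehension
    requires.\<close>
  have unique: "bit i a b = bit i a' b'"
    if "correct n a b" "correct n' a' b'" "i \<prec> n" "i \<prec> n'" for i n a b n' a' b'
  proof -
    have "i \<prec> n \<longrightarrow> i \<prec> n' \<longrightarrow> bit i a b = bit i a' b'"
    proof (rule Delta0_less_induct[of "\<lambda>i. i \<prec> n \<longrightarrow> i \<prec> n' \<longrightarrow> bit i a b = bit i a' b'"])
      show "Delta0 1 (\<lambda>e. e 0 \<prec> n \<longrightarrow> e 0 \<prec> n' \<longrightarrow> bit (e 0) a b = bit (e 0) a' b')"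
        by (intro D_imp D_less D_iff D_bit term_var term_const) simp_all
      fix i
      assume IH: "\<And>m. m \<prec> i \<Longrightarrow> m \<prec> n \<longrightarrow> m \<prec> n' \<longrightarrow> bit m a b = bit m a' b'"
      show "i \<prec> n \<longrightarrow> i \<prec> n' \<longrightarrow> bit i a b = bit i a' b'"
      proof (intro impI)
        assume i: "i \<prec> n" "i \<prec> n'"
        have "\<Phi> i (\<lambda>j. bit j a b) = \<Phi> i (\<lambda>j. bit j a' b')"
          using IH less_trans' i by (intro local) blast
        then show "bit i a b = bit i a' b'" using that(1,2) i unfolding correct_def by simp
      qed
    qed
    with that show ?thesis by blast
  qed
  have D_correct: "Delta0 k (\<lambda>e. correct (f e) (g e) (h e))"
    if "term_def k f" "term_def k g" "term_def k h" for k f g h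
    unfolding correct_def using that
    by (intro D_ball D_iff D_bit D_subst3[OF \<Phi>] term_def_Suc term_var) simp_all
  \<comment> \<open>One bound \<open>w\<close> for \<open>a\<close> and \<open>b\<close> leaves a
    single unbounded quantifier. Correctness is demanded below \<open>n \<oplus> \<one>\<close> so
    that the bit at \<open>n\<close> itself is determined.\<close>
  let ?A = "\<lambda>w n. \<exists>a. a \<prec> w \<and> (\<exists>b. b \<prec> w \<and> correct (n \<oplus> \<one>) a b \<and> bit n a b)"
  let ?B = "\<lambda>w n. \<forall>a. a \<prec> w \<longrightarrow> (\<forall>b. b \<prec> w \<longrightarrow> correct (n \<oplus> \<one>) a b \<longrightarrow> bit n a b)"
  have bound: "\<exists>w. a \<prec> w \<and> b \<prec> w" for a b
    using less_Suc_code by blast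
  have A: "(\<exists>w. ?A w n) \<longleftrightarrow> (\<exists>a b. correct (n \<oplus> \<one>) a b \<and> bit n a b)" for n
    using bound by blast
  have B: "(\<forall>w. ?B w n) \<longleftrightarrow> (\<forall>a b. correct (n \<oplus> \<one>) a b \<longrightarrow> bit n a b)" for n
    using bound by blast
  have less_self: "n \<prec> n \<oplus> \<one>" for n
    by (simp add: less_Suc)
  have "\<exists>X. \<forall>n. mem n X \<longleftrightarrow> (\<exists>w. ?A w n)"
  proof (rule Delta1_comprehension[of ?A ?B])
    show "Delta0 2 (\<lambda>e. ?A (e 0) (e 1))"
      by (intro D_bex D_conj D_correct D_bit term_var term_const term_add) simp_all
    show "Delta0 2 (\<lambda>e. ?B (e 0) (e 1))"
      by (intro D_ball D_imp D_correct D_bit term_var term_const term_add) simp_all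
    show "(\<exists>w. ?A w n) \<longleftrightarrow> (\<forall>w. ?B w n)" for n
      unfolding A B using exists unique less_self by blast
  qed
  then obtain X where X: "\<And>n. mem n X \<longleftrightarrow> (\<exists>a b. correct (n \<oplus> \<one>) a b \<and> bit n a b)"
    unfolding A by blast
  have "mem n X = \<Phi> n (\<lambda>j. mem j X)" for n
  proof -
    obtain a b where c: "correct (n \<oplus> \<one>) a b" using exists by blast
    have eq: "mem j X = bit j a b" if "j \<prec> n \<oplus> \<one>" for j
      unfolding X using exists unique[OF _ c less_self that] c by blast
    have "mem n X = \<Phi> n (\<lambda>j. bit j a b)"
      using eq[OF less_self] c less_self unfolding correct_def by blast
    also have "\<dots> = \<Phi> n (\<lambda>j. mem j X)"
      by (rule local) (use eq in \<open>auto simp: less_Suc\<close>)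
    finally show ?thesis .
  qed
  then show ?thesis by blast
qed

section \<open>Pigeonhole principle\<close>

text \<open>The model has no cardinalities, so counting is done by a recursively defined threshold
  predicate \<open>C\<close>. Induction on \<open>j\<close> shows that at most \<open>j\<close>
  numbers are sent below \<open>j\<close>, since at most one is sent to \<open>j\<close> itself. The
  unbounded set \<open>S\<close>, however, pushes the count for \<open>N\<close> beyond every
  number.\<close>

lemma pigeonhole:
  assumes G: "Delta0 2 (\<lambda>e. G (e 0) (e 1))"
    and total: "\<And>t. n \<prec> t \<Longrightarrow> mem t S \<Longrightarrow> \<exists>i. i \<prec> N \<and> G t i"
    and inj: "\<And>t t' i. G t i \<Longrightarrow> G t' i \<Longrightarrow> t = t'"
    and unbounded: "\<And>b. \<exists>t. b \<prec> t \<and> mem t S"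
  shows False
proof -
  define \<Phi> where "\<Phi> m A \<longleftrightarrow>
    (\<exists>t. t \<prec> m \<oplus> \<one> \<and> (\<exists>j. j \<prec> m \<oplus> \<one> \<and> (\<exists>c. c \<prec> m \<oplus> \<one> \<and> m = code (code t j) c \<and>
      (c = \<zero> \<or> (\<exists>t'. t' \<prec> t \<and> t = t' \<oplus> \<one> \<and> (A (code (code t' j) c) \<or>
        (\<exists>i. i \<prec> j \<and> G t' i) \<and> (\<exists>c'. c' \<prec> c \<and> c = c' \<oplus> \<one> \<and> A (code (code t' j) c'))))))))"
    for m and A :: "'a \<Rightarrow> bool"
  \<comment> \<open>Recursive calls lower \<open>t\<close> and do not raise \<open>c\<close>, so
    they reach smaller codes.\<close>
  have pred_less: "code (code t' j) c' \<prec> code (code t j) c" if "t' \<prec> t" "c' \<preceq> c" for t' t j c' c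
    using that by (intro code_less A.add_less_le_mono A.add_strict_right_mono) auto
  have "\<exists>X. \<forall>m. mem m X = \<Phi> m (\<lambda>j. mem j X)"
  proof (rule recursive_set)
    show "Delta0 3 (\<lambda>e. \<Phi> (e 0) (\<lambda>j. bit j (e 1) (e 2)))"
      unfolding \<Phi>_def
      by (intro D_bex D_conj D_disj D_eq D_bit D_subst2[OF G] term_code term_var term_add term_const)
        simp_all
    have "\<Phi> m B" if AB: "\<And>j. j \<prec> m \<Longrightarrow> A j = B j" and "\<Phi> m A" for m A B
    proof -
      obtain t j c where
        tjc: "t \<prec> m \<oplus> \<one>" "j \<prec> m \<oplus> \<one>" "c \<prec> m \<oplus> \<one>" "m = code (code t j) c"
        and d: "c = \<zero> \<or> (\<exists>t'. t' \<prec> t \<and> t = t' \<oplus> \<one> \<and> (A (code (code t' j) c) \<or>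
        (\<exists>i. i \<prec> j \<and> G t' i) \<and> (\<exists>c'. c' \<prec> c \<and> c = c' \<oplus> \<one> \<and> A (code (code t' j) c'))))"
        using \<open>\<Phi> m A\<close> unfolding \<Phi>_def by blast
      have "A (code (code t' j) c) = B (code (code t' j) c)" if "t' \<prec> t" for t'
        using pred_less[OF that A.order_refl] AB tjc(4) by blast
      moreover have "A (code (code t' j) c') = B (code (code t' j) c')" if "t' \<prec> t" "c' \<prec> c" for t' c'
        using pred_less[OF that(1), of c' c] that(2) AB tjc(4) A.less_imp_le by blast
      ultimately have "c = \<zero> \<or> (\<exists>t'. t' \<prec> t \<and> t = t' \<oplus> \<one> \<and> (B (code (code t' j) c) \<or>
        (\<exists>i. i \<prec> j \<and> G t' i) \<and> (\<exists>c'. c' \<prec> c \<and> c = c' \<oplus> \<one> \<and> B (code (code t' j) c'))))"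
        using d by blast
      with tjc show ?thesis unfolding \<Phi>_def by blast
    qed
    then show "\<Phi> m A = \<Phi> m B" if "\<And>j. j \<prec> m \<Longrightarrow> A j = B j" for m A B
      using that by (metis (full_types))
  qed
  then obtain X where X: "\<And>m. mem m X = \<Phi> m (\<lambda>j. mem j X)" by blast
  \<comment> \<open>at least \<open>c\<close> of the numbers below \<open>t\<close> are sent below \<open>j\<close>\<close>
  define C where "C t j c \<longleftrightarrow> mem (code (code t j) c) X" for t j c
  have D_C: "Delta0 k (\<lambda>e. C (f e) (g e) (h e))" if "term_def k f" "term_def k g" "term_def k h" for k f g h
    unfolding C_def using that by (intro D_mem term_code)
  have lt: "t \<prec> code (code t j) c \<oplus> \<one>" "j \<prec> code (code t j) c \<oplus> \<one>" "c \<prec> code (code t j) c \<oplus> \<one>"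
    for t j c
    using le_code A.order_trans unfolding less_Suc_le by metis+
  have C: "C t j c \<longleftrightarrow> c = \<zero> \<or> (\<exists>t'. t' \<prec> t \<and> t = t' \<oplus> \<one> \<and> (C t' j c \<or>
        (\<exists>i. i \<prec> j \<and> G t' i) \<and> (\<exists>c'. c' \<prec> c \<and> c = c' \<oplus> \<one> \<and> C t' j c')))" for t j c
    unfolding C_def by (subst X) (use lt in \<open>auto simp: \<Phi>_def\<close>)
  have less_self: "m \<prec> m \<oplus> \<one>" for m
    by (simp add: less_Suc)
  have C_0: "C t j \<zero>" for t j
    using C by blast
  have C_zero: "C \<zero> j c \<longleftrightarrow> c = \<zero>" for j c
    using C[of \<zero> j c] by simp
  have C_Suc: "C (t \<oplus> \<one>) j (c \<oplus> \<one>) \<longleftrightarrow> C t j (c \<oplus> \<one>) \<or> (\<exists>i. i \<prec> j \<and> G t i) \<and> C t j c" for t j c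
    using C[of "t \<oplus> \<one>" j "c \<oplus> \<one>"] less_self by auto
  have C_mono: "C (t \<oplus> \<one>) j c" if "C t j c" for t j c
    using zero_or_Suc[of c] that C_0 C_Suc by blast
  \<comment> \<open>Passing from \<open>j \<oplus> \<one>\<close> to \<open>j\<close> costs at most
    one, and costs nothing while \<open>j\<close> has not been hit. The first claim needs the second
    at the one \<open>t\<close> that is sent to \<open>j\<close>.\<close>
  have step: "(C t (j \<oplus> \<one>) (c \<oplus> \<one>) \<longrightarrow> C t j c) \<and>
      ((\<forall>s. s \<prec> t \<longrightarrow> \<not> G s j) \<longrightarrow> C t (j \<oplus> \<one>) c \<longrightarrow> C t j c)" for t j c
  proof -
    \<comment> \<open>The induction on \<open>t\<close> uses the claims at the predecessor of the
      threshold as well, so they are quantified over \<open>d\<close>; the bound by \<open>c\<close>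
      keeps the formula bounded.\<close>
    let ?P = "\<lambda>t. \<forall>d. d \<prec> c \<oplus> \<one> \<longrightarrow> (C t (j \<oplus> \<one>) (d \<oplus> \<one>) \<longrightarrow> C t j d) \<and>
      ((\<forall>s. s \<prec> t \<longrightarrow> \<not> G s j) \<longrightarrow> C t (j \<oplus> \<one>) d \<longrightarrow> C t j d)"
    have "?P t"
    proof (rule Delta0_induct[of ?P])
      show "Delta0 1 (\<lambda>e. ?P (e 0))"
        by (intro D_ball D_conj D_imp D_C D_not D_subst2[OF G] term_var term_add term_const) simp_all
      show "?P \<zero>" by (simp add: C_zero)
      fix t
      assume IH: "?P t"
      have IH1: "C t j d" if "d \<prec> c \<oplus> \<one>" "C t (j \<oplus> \<one>) (d \<oplus> \<one>)" for d
        using IH that by blast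
      have IH2: "C t j d" if "d \<prec> c \<oplus> \<one>" "C t (j \<oplus> \<one>) d" "\<forall>s. s \<prec> t \<longrightarrow> \<not> G s j" for d
        using IH that by blast
      show "?P (t \<oplus> \<one>)"
      proof (intro allI impI conjI)
        fix d
        assume d: "d \<prec> c \<oplus> \<one>" and "C (t \<oplus> \<one>) (j \<oplus> \<one>) (d \<oplus> \<one>)"
        then consider "C t (j \<oplus> \<one>) (d \<oplus> \<one>)" | i where "i \<prec> j \<oplus> \<one>" "G t i" "C t (j \<oplus> \<one>) d"
          using C_Suc by blast
        then show "C (t \<oplus> \<one>) j d"
        proof cases
          case 1
          then show ?thesis using IH1[OF d] C_mono by blast
        next
          case 2
          show ?thesis
          proof (cases "i = j")
            case True
            then have "\<forall>s. s \<prec> t \<longrightarrow> \<not> G s j" using inj 2(2) not_less_self by blast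
            then show ?thesis using IH2[OF d 2(3)] C_mono by blast
          next
            case False
            then have i: "i \<prec> j" using 2(1) less_Suc by blast
            show ?thesis
            proof (cases "d = \<zero>")
              case True
              then show ?thesis using C_0 by simp
            next
              case False
              then obtain d' where d': "d = d' \<oplus> \<one>" using zero_or_Suc by blast
              then have "d' \<prec> c \<oplus> \<one>" using d less_self less_trans' by blast
              then have "C t j d'" using IH1 2(3) d' by simp
              then show ?thesis unfolding d' C_Suc using i 2(2) by blast
            qed
          qed
        qed
      next
        fix d
        assume d: "d \<prec> c \<oplus> \<one>" and no: "\<forall>s. s \<prec> t \<oplus> \<one> \<longrightarrow> \<not> G s j"
          and Cd: "C (t \<oplus> \<one>) (j \<oplus> \<one>) d"
        then have no': "\<not> G t j" "\<forall>s. s \<prec> t \<longrightarrow> \<not> G s j" using less_Suc by blast+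
        show "C (t \<oplus> \<one>) j d"
        proof (cases "d = \<zero>")
          case True
          then show ?thesis using C_0 by simp
        next
          case False
          then obtain d' where d': "d = d' \<oplus> \<one>" using zero_or_Suc by blast
          then have lt': "d' \<prec> c \<oplus> \<one>" using d less_self less_trans' by blast
          have "C t (j \<oplus> \<one>) d \<or> (\<exists>i. i \<prec> j \<and> G t i) \<and> C t (j \<oplus> \<one>) d'"
            using Cd no'(1) unfolding d' C_Suc less_Suc by blast
          then show ?thesis using IH2[OF d _ no'(2)] IH2[OF lt' _ no'(2)] C_mono d' C_Suc by blast
        qed
      qed
    qed
    then show ?thesis using less_self by blast
  qed
  have bounded: "\<not> C t j (j \<oplus> \<one>)" for t j
  proof (rule Delta0_induct[of "\<lambda>j. \<not> C t j (j \<oplus> \<one>)"])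
    show "Delta0 1 (\<lambda>e. \<not> C t (e 0) (e 0 \<oplus> \<one>))"
      by (intro D_not D_C term_add term_var term_const) simp_all
    show "\<not> C t \<zero> (\<zero> \<oplus> \<one>)"
    proof (rule Delta0_induct[of "\<lambda>t. \<not> C t \<zero> (\<zero> \<oplus> \<one>)"])
      show "Delta0 1 (\<lambda>e. \<not> C (e 0) \<zero> (\<zero> \<oplus> \<one>))"
        by (intro D_not D_C term_add term_var term_const) simp_all
    qed (simp_all only: C_zero C_Suc, simp_all)
    show "\<not> C t (j \<oplus> \<one>) (j \<oplus> \<one> \<oplus> \<one>)" if "\<not> C t j (j \<oplus> \<one>)" for j
      using that step by blast
  qed
  have C_add: "C (t \<oplus> d) j c" if "C t j c" for t d j c
  proof (rule Delta0_induct[of "\<lambda>d. C (t \<oplus> d) j c"])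
    show "Delta0 1 (\<lambda>e. C (t \<oplus> e 0) j c)"
      by (intro D_C term_add term_var term_const) simp_all
  qed (use that C_mono in \<open>auto simp: add_Suc\<close>)
  have "\<exists>t. C t N c" for c
  proof (rule Sigma1_induct[of "\<lambda>t c. C t N c"])
    show "Delta0 2 (\<lambda>e. C (e 0) N (e 1))"
      by (intro D_C term_var term_const) simp_all
    show "\<exists>t. C t N \<zero>" using C_0 by blast
    fix c
    assume "\<exists>t. C t N c"
    then obtain t where t: "C t N c" by blast
    \<comment> \<open>Beyond \<open>n\<close>, the number \<open>s\<close> is sent below
      \<open>N\<close>; beyond \<open>t\<close>, it has not been counted yet. It raises the count at
      \<open>s \<oplus> \<one>\<close>.\<close>
    obtain s where s: "n \<oplus> t \<prec> s" "mem s S" using unbounded by blast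
    have "n \<preceq> n \<oplus> t" "t \<preceq> n \<oplus> t" using le_iff_add add_com by blast+
    then have "n \<prec> s" "t \<preceq> s" using s(1) A.le_less_trans A.less_imp_le by blast+
    then obtain d where "s = t \<oplus> d" using le_iff_add by blast
    then have "C s N c" using C_add[OF t] by simp
    moreover have "\<exists>i. i \<prec> N \<and> G s i" using total[OF \<open>n \<prec> s\<close> s(2)] .
    ultimately show "\<exists>t. C t N (c \<oplus> \<one>)" using C_Suc by blast
  qed
  then show False using bounded by blast
qed

section \<open>Semantics of the two principles\<close>

text \<open>Conjunction and existence are abbreviations through implication and falsity; these
  equivalences clear the nested negations that their semantics leaves behind.\<close>

lemma not_conj_not: "\<not> (P \<and> \<not> Q) \<longleftrightarrow> (P \<longrightarrow> Q)" "\<not> (P \<and> (\<forall>x. \<not> R x)) \<longleftrightarrow> (P \<longrightarrow> (\<exists>x. R x))"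
  by blast+

lemmas sat_unfold = sat.simps teval_pair teval.simps eval_nat_numeral BitM.simps One_nat_def
  old.nat.case simp_thms not_imp not_not not_all not_ex not_conj_not

lemma sat_infinite_set: "sat e S (infinite_set X) \<longleftrightarrow> (\<forall>b. \<exists>t. b \<prec> t \<and> mem t (S X))"
  by (simp add: infinite_set_def)

lemma sat_tournament: "sat e S (tournament D T) \<longleftrightarrow>
    (\<forall>n. mem n (S T) \<longrightarrow> (\<exists>x y. mem x (S D) \<and> mem y (S D) \<and> n = code x y)) \<and>
    (\<forall>x. mem x (S D) \<longrightarrow> \<not> mem (code x x) (S T)) \<and>
    (\<forall>x y. mem x (S D) \<and> mem y (S D) \<and> x \<noteq> y \<longrightarrow>
      (mem (code x y) (S T) \<longrightarrow> \<not> mem (code y x) (S T)) \<and>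
      (\<not> mem (code y x) (S T) \<longrightarrow> mem (code x y) (S T)))"
  by (simp only: tournament_def rel_def sat_unfold ex_simps)

lemma sat_stable: "sat e S (stable D T) \<longleftrightarrow>
    (\<forall>x. mem x (S D) \<longrightarrow>
      (\<exists>b. \<forall>s. mem s (S D) \<and> b \<prec> s \<longrightarrow> mem (code x s) (S T)) \<or>
      (\<exists>b. \<forall>s. mem s (S D) \<and> b \<prec> s \<longrightarrow> mem (code s x) (S T)))"
  by (simp add: stable_def rel_def disj_imp imp_conjL)

lemma sat_transitive_on: "sat e S (transitive_on H T) \<longleftrightarrow>
    (\<forall>x y z. mem x (S H) \<and> mem y (S H) \<and> mem z (S H) \<and>
      mem (code x y) (S T) \<and> mem (code y z) (S T) \<longrightarrow> mem (code x z) (S T))"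
  by (simp add: transitive_on_def rel_def conj_ac)

lemma sat_coloring: "sat e S (coloring F) \<longleftrightarrow>
    (\<forall>n. mem n (S F) \<longrightarrow> (\<exists>x s c. x \<prec> s \<and> n = code (code x s) c)) \<and>
    (\<forall>x s. x \<prec> s \<longrightarrow>
      (\<exists>c. mem (code (code x s) c) (S F) \<and> (\<forall>c'. mem (code (code x s) c') (S F) \<longrightarrow> c' = c)))"
  by (simp only: coloring_def val_def sat_unfold)

lemma sat_two_bounded: "sat e S (two_bounded F) \<longleftrightarrow>
    (\<forall>c p q r. mem (code p c) (S F) \<and> mem (code q c) (S F) \<and> mem (code r c) (S F) \<longrightarrow>
      p = q \<or> p = r \<or> q = r)"
  by (simp add: two_bounded_def disj_imp)

lemma sat_rainbow_stable: "sat e S (rainbow_stable F) \<longleftrightarrow>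
    (\<forall>x. (\<exists>y. y \<noteq> x \<and> (\<exists>b. \<forall>s. b \<prec> s \<longrightarrow>
        (\<exists>c. mem (code (code x s) c) (S F) \<and> mem (code (code y s) c) (S F)))) \<or>
      (\<exists>b. \<forall>s. b \<prec> s \<longrightarrow> \<not> (\<exists>y. y \<noteq> x \<and>
        (\<exists>c. mem (code (code x s) c) (S F) \<and> mem (code (code y s) c) (S F)))))"
  by (simp add: rainbow_stable_def same_val_def val_def disj_imp)

lemma sat_rainbow: "sat e S (rainbow R F) \<longleftrightarrow>
    (\<forall>x s y t c. mem x (S R) \<and> mem s (S R) \<and> mem y (S R) \<and> mem t (S R) \<and> x \<prec> s \<and> y \<prec> t \<and>
      mem (code (code x s) c) (S F) \<and> mem (code (code y t) c) (S F) \<longrightarrow> x = y \<and> s = t)"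
  by (simp only: rainbow_def val_def sat_unfold)

end

section \<open>From transitive subtournaments to rainbows\<close>

locale stable_coloring = RCA0_model +
  fixes F
  assumes graph: "mem n F \<Longrightarrow> \<exists>x s c. less x s \<and> n = code (code x s) c"
    and total: "less x s \<Longrightarrow>
      \<exists>c. mem (code (code x s) c) F \<and> (\<forall>c'. mem (code (code x s) c') F \<longrightarrow> c' = c)"
    and two_bounded: "mem (code p c) F \<Longrightarrow> mem (code q c) F \<Longrightarrow> mem (code r c) F \<Longrightarrow>
      p = q \<or> p = r \<or> q = r"
    and rainbow_stable: "(\<exists>y. y \<noteq> x \<and> (\<exists>b. \<forall>s. less b s \<longrightarrow>
        (\<exists>c. mem (code (code x s) c) F \<and> mem (code (code y s) c) F))) \<or>
      (\<exists>b. \<forall>s. less b s \<longrightarrow> \<not> (\<exists>y. y \<noteq> x \<and>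
        (\<exists>c. mem (code (code x s) c) F \<and> mem (code (code y s) c) F)))"
begin

section \<open>Comparing colors within the model\<close>

definition eq_color :: "'a \<Rightarrow> 'a \<Rightarrow> 'a \<Rightarrow> 'a \<Rightarrow> bool" where
  "eq_color x s y t \<longleftrightarrow> (\<exists>c. mem (code (code x s) c) F \<and> mem (code (code y t) c) F)"

lemma mem_color_less: "mem (code (code x s) c) F \<Longrightarrow> x \<prec> s"
  using graph by fastforce

lemma color_unique: "mem (code (code x s) c) F \<Longrightarrow> mem (code (code x s) c') F \<Longrightarrow> c = c'"
  using total[OF mem_color_less] by blast

lemma eq_color_less: "eq_color x s y t \<Longrightarrow> x \<prec> s" "eq_color x s y t \<Longrightarrow> y \<prec> t"
  unfolding eq_color_def using mem_color_less by blast+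

lemma eq_color_sym: "eq_color x s y t \<Longrightarrow> eq_color y t x s"
  unfolding eq_color_def by blast

lemma eq_color_two_bounded:
  assumes "eq_color x s y t" "eq_color x s y' t'"
  shows "(x = y \<and> s = t) \<or> (x = y' \<and> s = t') \<or> (y = y' \<and> t = t')"
proof -
  obtain c where "mem (code (code x s) c) F" "mem (code (code y t) c) F" "mem (code (code y' t') c) F"
    using assms color_unique unfolding eq_color_def by blast
  then show ?thesis using two_bounded by fastforce
qed

text \<open>On the domain of the coloring, "some color is shared" is equivalent to "every color of
  the first pair is one of the second", by totality and uniqueness of colors. The two forms have
  opposite unbounded quantifiers, so comprehension applies.\<close>

lemma eq_color_set: "\<exists>E. \<forall>x s y t. mem (code (code x s) (code y t)) E \<longleftrightarrow> eq_color x s y t"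
proof -
  \<comment> \<open>Outside the domain the universal form would hold vacuously, so it must test
    membership in the domain itself.\<close>
  define dom where
    "dom p \<longleftrightarrow> (\<exists>x. x \<prec> p \<oplus> \<one> \<and> (\<exists>s. s \<prec> p \<oplus> \<one> \<and> x \<prec> s \<and> p = code x s))" for p
  have dom: "dom (code x s) \<longleftrightarrow> x \<prec> s" for x s
    unfolding dom_def using less_Suc_code by auto
  have D_dom: "Delta0 k (\<lambda>e. dom (f e))" if "term_def k f" for k f
    unfolding dom_def using that
    by (intro D_bex D_conj D_less D_eq term_code term_add term_const term_var term_def_Suc) simp_all
  let ?A = "\<lambda>w n. \<exists>p. p \<prec> n \<oplus> \<one> \<and> (\<exists>q. q \<prec> n \<oplus> \<one> \<and> n = code p q \<and>
    mem (code p w) F \<and> mem (code q w) F)"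
  let ?B = "\<lambda>w n. \<exists>p. p \<prec> n \<oplus> \<one> \<and> (\<exists>q. q \<prec> n \<oplus> \<one> \<and> n = code p q \<and> dom p \<and> dom q \<and>
    (mem (code p w) F \<longrightarrow> mem (code q w) F))"
  have A: "?A w (code p q) \<longleftrightarrow> mem (code p w) F \<and> mem (code q w) F" for w p q
    using less_Suc_code by auto
  have B: "?B w (code p q) \<longleftrightarrow> dom p \<and> dom q \<and> (mem (code p w) F \<longrightarrow> mem (code q w) F)" for w p q
    using less_Suc_code by auto
  have AB: "(\<exists>w. mem (code p w) F \<and> mem (code q w) F) \<longleftrightarrow>
    (\<forall>w. dom p \<and> dom q \<and> (mem (code p w) F \<longrightarrow> mem (code q w) F))" for p q
  proof
    assume "\<exists>w. mem (code p w) F \<and> mem (code q w) F"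
    then obtain w where w: "mem (code p w) F" "mem (code q w) F" by blast
    obtain x s where p: "x \<prec> s" "p = code x s" using graph[OF w(1)] by auto
    obtain y t where q: "y \<prec> t" "q = code y t" using graph[OF w(2)] by auto
    show "\<forall>w. dom p \<and> dom q \<and> (mem (code p w) F \<longrightarrow> mem (code q w) F)"
      using p q w color_unique dom by metis
  next
    assume *: "\<forall>w. dom p \<and> dom q \<and> (mem (code p w) F \<longrightarrow> mem (code q w) F)"
    then obtain x s where "x \<prec> s" "p = code x s" unfolding dom_def by blast
    then show "\<exists>w. mem (code p w) F \<and> mem (code q w) F" using total * by blast
  qed
  have "\<exists>E. \<forall>n. mem n E \<longleftrightarrow> (\<exists>w. ?A w n)"
  proof (rule Delta1_comprehension[of ?A ?B])
    show "Delta0 2 (\<lambda>e. ?A (e 0) (e 1))"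
      by (intro D_bex D_conj D_mem D_eq term_code term_add term_const term_var) simp_all
    show "Delta0 2 (\<lambda>e. ?B (e 0) (e 1))"
      by (intro D_bex D_conj D_mem D_eq D_imp D_dom term_code term_add term_const term_var) simp_all
    show "(\<exists>w. ?A w n) \<longleftrightarrow> (\<forall>w. ?B w n)" for n
    proof (cases "\<exists>p q. n = code p q")
      case True
      then obtain p q where n: "n = code p q" by blast
      show ?thesis unfolding n A B by (rule AB)
    qed blast
  qed
  then obtain E where E: "\<And>n. mem n E \<longleftrightarrow> (\<exists>w. ?A w n)" by blast
  have "mem (code (code x s) (code y t)) E \<longleftrightarrow> eq_color x s y t" for x s y t
    unfolding E A eq_color_def ..
  then show ?thesis by blast
qed

text \<open>
  If \<open>y < x\<close> have the same color at \<open>s\<close>, then the edges between \<open>y\<close>, \<open>x\<close> and \<open>s\<close> are made to form a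
  cycle: \<open>mem (code x s) U\<close> says that the edge points from \<open>x\<close> up to \<open>s\<close>. The edge between \<open>y\<close> and \<open>x\<close> has been
  chosen before, and the edges to \<open>s\<close> are adapted to it.
\<close>

lemma orientation_exists:
  "\<exists>U. (\<forall>x y s. y \<prec> x \<longrightarrow> eq_color x s y s \<longrightarrow>
      (mem (code x s) U \<longleftrightarrow> mem (code y x) U) \<and> (mem (code y s) U \<longleftrightarrow> \<not> mem (code y x) U)) \<and>
    (\<forall>x s. x \<prec> s \<longrightarrow> (\<forall>y. y \<noteq> x \<longrightarrow> \<not> eq_color x s y s) \<longrightarrow> mem (code x s) U)"
proof -
  obtain E where E: "\<And>x s y t. mem (code (code x s) (code y t)) E \<longleftrightarrow> eq_color x s y t"
    using eq_color_set by blast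
  \<comment> \<open>Edges point up unless a partner \<open>y\<close> of \<open>x\<close> at
    \<open>s\<close> prevents it. The larger partner copies the edge between the two, the smaller
    one reverses it.\<close>
  define \<Phi> where "\<Phi> n A \<longleftrightarrow> (\<exists>x. x \<prec> n \<oplus> \<one> \<and> (\<exists>s. s \<prec> n \<oplus> \<one> \<and> n = code x s \<and> x \<prec> s \<and>
    (\<forall>y. y \<prec> s \<longrightarrow> y \<noteq> x \<longrightarrow> mem (code (code x s) (code y s)) E \<longrightarrow>
      (y \<prec> x \<longrightarrow> A (code y x)) \<and> (x \<prec> y \<longrightarrow> \<not> A (code x y)))))"
    for n and A :: "'a \<Rightarrow> bool"
  have \<Phi>: "\<Phi> (code x s) A \<longleftrightarrow> x \<prec> s \<and> (\<forall>y. y \<prec> s \<longrightarrow> y \<noteq> x \<longrightarrow> eq_color x s y s \<longrightarrow>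
      (y \<prec> x \<longrightarrow> A (code y x)) \<and> (x \<prec> y \<longrightarrow> \<not> A (code x y)))" for x s A
    unfolding \<Phi>_def E using less_Suc_code by auto
  have "\<exists>U. \<forall>n. mem n U = \<Phi> n (\<lambda>j. mem j U)"
  proof (rule recursive_set)
    show "Delta0 3 (\<lambda>e. \<Phi> (e 0) (\<lambda>j. bit j (e 1) (e 2)))"
      unfolding \<Phi>_def
      by (intro D_bex D_ball D_conj D_imp D_not D_eq D_less D_mem D_bit term_code term_var term_add
          term_const) simp_all
    fix n and A B :: "'a \<Rightarrow> bool"
    assume AB: "\<And>j. j \<prec> n \<Longrightarrow> A j = B j"
    show "\<Phi> n A = \<Phi> n B"
    proof (cases "\<exists>x s. n = code x s")
      case True
      then obtain x s where n: "n = code x s" by blast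
      \<comment> \<open>The edge consulted joins \<open>x\<close> and \<open>y\<close> with
        \<open>y \<prec> s\<close>, so its sum, and with it its code, is smaller than that of
        \<open>x\<close> and \<open>s\<close>.\<close>
      have "A (code y x) = B (code y x)" "A (code x y) = B (code x y)" if "y \<prec> s" for y
        using that by (auto intro!: AB code_less A.add_strict_left_mono simp: n add_com[of y])
      then show ?thesis unfolding n \<Phi> by blast
    qed (auto simp: \<Phi>_def)
  qed
  then obtain U where U_rec: "\<And>n. mem n U = \<Phi> n (\<lambda>j. mem j U)" by blast
  have U: "mem (code x s) U \<longleftrightarrow> x \<prec> s \<and> (\<forall>y. y \<prec> s \<longrightarrow> y \<noteq> x \<longrightarrow> eq_color x s y s \<longrightarrow>
      (y \<prec> x \<longrightarrow> mem (code y x) U) \<and> (x \<prec> y \<longrightarrow> \<not> mem (code x y) U))" for x s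
    by (rule U_rec[of "code x s", unfolded \<Phi>])
  have "(mem (code x s) U \<longleftrightarrow> mem (code y x) U) \<and> (mem (code y s) U \<longleftrightarrow> \<not> mem (code y x) U)"
    if yx: "y \<prec> x" and eq: "eq_color x s y s" for x y s
  proof -
    have *: "x \<prec> s" "y \<prec> s" "y \<noteq> x" "\<not> x \<prec> y"
      using eq_color_less[OF eq] yx not_less_self less_trans' by blast+
    \<comment> \<open>At \<open>s\<close> each of \<open>x\<close> and \<open>y\<close> has only the
      other as partner, so the quantifier in \<open>U\<close> imposes just one condition on each
      edge.\<close>
    have "z = y" if "eq_color x s z s" "z \<noteq> x" for z
      using eq_color_two_bounded[OF eq that(1)] that(2) *(3) by blast
    moreover have "z = x" if "eq_color y s z s" "z \<noteq> y" for z
      using eq_color_two_bounded[OF eq_color_sym[OF eq] that(1)] that(2) *(3) by blast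
    ultimately show ?thesis
      using * yx eq eq_color_sym[OF eq] U[of x s] U[of y s] by blast
  qed
  moreover have "mem (code x s) U" if "x \<prec> s" "\<forall>y. y \<noteq> x \<longrightarrow> \<not> eq_color x s y s" for x s
    using that U by blast
  ultimately show ?thesis by blast
qed

lemma stable_tournament_exists:
  obtains D T where "\<And>n. mem n D"
    and "\<And>x. \<not> mem (code x x) T"
    and "\<And>x y. x \<noteq> y \<Longrightarrow> mem (code x y) T \<longleftrightarrow> \<not> mem (code y x) T"
    and "\<And>n. mem n T \<Longrightarrow> \<exists>x y. n = code x y"
    and "\<And>x. (\<exists>b. \<forall>s. b \<prec> s \<longrightarrow> mem (code x s) T) \<or> (\<exists>b. \<forall>s. b \<prec> s \<longrightarrow> mem (code s x) T)"
    and "\<And>x y s. y \<prec> x \<Longrightarrow> eq_color x s y s \<Longrightarrow>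
      (mem (code y x) T \<and> mem (code x s) T \<and> mem (code s y) T) \<or>
      (mem (code x y) T \<and> mem (code y s) T \<and> mem (code s x) T)"
proof -
  obtain U where
    U: "\<And>x y s. y \<prec> x \<Longrightarrow> eq_color x s y s \<Longrightarrow> mem (code x s) U \<longleftrightarrow> mem (code y x) U"
      "\<And>x y s. y \<prec> x \<Longrightarrow> eq_color x s y s \<Longrightarrow> mem (code y s) U \<longleftrightarrow> \<not> mem (code y x) U"
      "\<And>x s. x \<prec> s \<Longrightarrow> \<forall>y. y \<noteq> x \<longrightarrow> \<not> eq_color x s y s \<Longrightarrow> mem (code x s) U"
    using orientation_exists by metis
  obtain D where D: "\<And>n. mem n D" using Delta0_comprehension[of "\<lambda>_. True"] D_const by blast
  \<comment> \<open>\<open>U\<close> decides only the upward direction of each pair;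
    \<open>T\<close> adds the downward edges as its complement.\<close>
  let ?T = "\<lambda>n. \<exists>x. x \<prec> n \<oplus> \<one> \<and> (\<exists>y. y \<prec> n \<oplus> \<one> \<and> n = code x y \<and>
    (x \<prec> y \<and> mem (code x y) U \<or> y \<prec> x \<and> \<not> mem (code y x) U))"
  have "\<exists>T. \<forall>n. mem n T \<longleftrightarrow> ?T n"
    by (rule Delta0_comprehension)
      (intro D_bex D_conj D_disj D_not D_eq D_less D_mem term_code term_var term_add term_const,
        simp_all)
  then obtain T where T: "\<And>n. mem n T \<longleftrightarrow> ?T n" by blast
  have T_code: "mem (code x y) T \<longleftrightarrow> x \<prec> y \<and> mem (code x y) U \<or> y \<prec> x \<and> \<not> mem (code y x) U" for x y
    unfolding T using less_Suc_code by auto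
  have T_up: "mem (code x y) T \<longleftrightarrow> mem (code x y) U" "mem (code y x) T \<longleftrightarrow> \<not> mem (code x y) U"
    if "x \<prec> y" for x y
    using that less_trans' not_less_self unfolding T_code by blast+
  have stab: "(\<exists>b. \<forall>s. b \<prec> s \<longrightarrow> mem (code x s) T) \<or> (\<exists>b. \<forall>s. b \<prec> s \<longrightarrow> mem (code s x) T)" for x
    using rainbow_stable[of x]
  proof
    assume "\<exists>y. y \<noteq> x \<and> (\<exists>b. \<forall>s. b \<prec> s \<longrightarrow>
        (\<exists>c. mem (code (code x s) c) F \<and> mem (code (code y s) c) F))"
    then obtain y b where y: "y \<noteq> x" "\<And>s. b \<prec> s \<Longrightarrow> eq_color x s y s"
      unfolding eq_color_def by blast
    have xs: "x \<prec> s" if "b \<prec> s" for s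
      using eq_color_less(1)[OF y(2)[OF that]] .
    \<comment> \<open>The edge between \<open>x\<close> and \<open>y\<close> does not depend on
      \<open>s\<close>, and it fixes the direction at all \<open>s\<close> beyond
      \<open>b\<close>.\<close>
    have "(\<forall>s. b \<prec> s \<longrightarrow> mem (code x s) U) \<or> (\<forall>s. b \<prec> s \<longrightarrow> \<not> mem (code x s) U)"
      using y U(1)[of y x] U(2)[of x y] eq_color_sym less_linear'[of x y] by blast
    then show ?thesis using T_up xs by blast
  next
    assume "\<exists>b. \<forall>s. b \<prec> s \<longrightarrow> \<not> (\<exists>y. y \<noteq> x \<and>
        (\<exists>c. mem (code (code x s) c) F \<and> mem (code (code y s) c) F))"
    then obtain b where b: "\<And>s y. b \<prec> s \<Longrightarrow> y \<noteq> x \<Longrightarrow> \<not> eq_color x s y s"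
      unfolding eq_color_def by blast
    \<comment> \<open>\<open>code b x\<close> serves as a common upper bound of \<open>b\<close> and
      \<open>x\<close>.\<close>
    have "mem (code x s) T" if "code b x \<prec> s" for s
    proof -
      have "b \<prec> s" "x \<prec> s" using that le_code A.le_less_trans by blast+
      then show ?thesis using b U(3) T_up by blast
    qed
    then show ?thesis by blast
  qed
  have cyc: "(mem (code y x) T \<and> mem (code x s) T \<and> mem (code s y) T) \<or>
      (mem (code x y) T \<and> mem (code y s) T \<and> mem (code s x) T)"
    if "y \<prec> x" "eq_color x s y s" for x y s
    using U(1,2)[OF that] T_up[OF that(1)] T_up[OF eq_color_less(1)[OF that(2)]]
      T_up[OF eq_color_less(2)[OF that(2)]] by blast
  have asym: "mem (code x y) T \<longleftrightarrow> \<not> mem (code y x) T" if "x \<noteq> y" for x y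
    using that less_linear'[of x y] T_up by blast
  have irr: "\<not> mem (code x x) T" for x unfolding T_code by simp
  have codes: "\<exists>x y. n = code x y" if "mem n T" for n using that unfolding T by blast
  show ?thesis
    by (rule that[OF D irr asym codes stab cyc])
qed

text \<open>
  A greedy thinning of \<open>H\<close> takes care of pairs with different maxima. It does not stop: each
  element beyond the last one taken would have the color of a pair below that one, and different
  elements would use different pairs.
\<close>

lemma rainbow_exists:
  assumes H: "\<And>b. \<exists>t. b \<prec> t \<and> mem t H"
    and no_eq: "\<forall>x y s. mem x H \<and> mem y H \<and> mem s H \<and> eq_color x s y s \<longrightarrow> x = y"
  shows "\<exists>R. (\<forall>b. \<exists>t. b \<prec> t \<and> mem t R) \<and>
    (\<forall>x s y t. mem x R \<longrightarrow> mem s R \<longrightarrow> mem y R \<longrightarrow> mem t R \<longrightarrow> eq_color x s y t \<longrightarrow> x = y \<and> s = t)"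
proof -
  obtain E where E: "\<And>x s y t. mem (code (code x s) (code y t)) E \<longleftrightarrow> eq_color x s y t"
    using eq_color_set by blast
  \<comment> \<open>Only pairs with maximum below \<open>n\<close> are compared with the new ones;
    two pairs with the same maximum are covered by \<open>no_eq\<close>.\<close>
  define \<Phi> where "\<Phi> n A \<longleftrightarrow> mem n H \<and> (\<forall>x. x \<prec> n \<longrightarrow> (\<forall>s. s \<prec> n \<longrightarrow> (\<forall>y. y \<prec> n \<longrightarrow>
    A x \<longrightarrow> A s \<longrightarrow> A y \<longrightarrow> \<not> mem (code (code x s) (code y n)) E)))" for n A
  have "\<exists>R. \<forall>n. mem n R = \<Phi> n (\<lambda>j. mem j R)"
  proof (rule recursive_set)
    show "Delta0 3 (\<lambda>e. \<Phi> (e 0) (\<lambda>j. bit j (e 1) (e 2)))"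
      unfolding \<Phi>_def
      by (intro D_ball D_conj D_imp D_not D_mem D_bit term_code term_var) simp_all
  qed (auto simp: \<Phi>_def)
  then obtain R where "\<And>n. mem n R = \<Phi> n (\<lambda>j. mem j R)" by blast
  then have R: "mem n R \<longleftrightarrow> mem n H \<and> (\<forall>x s y. x \<prec> n \<longrightarrow> s \<prec> n \<longrightarrow> y \<prec> n \<longrightarrow>
      mem x R \<longrightarrow> mem s R \<longrightarrow> mem y R \<longrightarrow> \<not> eq_color x s y n)" for n
    unfolding \<Phi>_def E by blast
  have "\<exists>t. b \<prec> t \<and> mem t R" for b
  proof (rule ccontr)
    assume "\<nexists>t. b \<prec> t \<and> mem t R"
    then have b: "t \<preceq> b" if "mem t R" for t using that A.not_less by blast
    \<comment> \<open>If \<open>R\<close> ends at \<open>b\<close>, each rejected \<open>t\<close>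
      points to an earlier pair from \<open>R\<close> whose color it would repeat. The entries of
      that pair satisfy \<open>x \<prec> s\<close> and \<open>s \<preceq> b\<close>, so its code
      lies below \<open>code b b\<close>.\<close>
    define G where "G t i \<longleftrightarrow> (\<exists>x. x \<prec> t \<and> (\<exists>s. s \<prec> t \<and> (\<exists>y. y \<prec> t \<and> mem s R \<and> mem y R \<and>
      i = code x s \<and> mem (code (code x s) (code y t)) E)))" for t i
    show False
    proof (rule pigeonhole)
      show "Delta0 2 (\<lambda>e. G (e 0) (e 1))"
        unfolding G_def by (intro D_bex D_conj D_eq D_mem term_code term_var) simp_all
      show "\<exists>i. i \<prec> code b b \<and> G t i" if bt: "b \<prec> t" and tH: "mem t H" for t
      proof -
        have "\<not> mem t R" using bt b A.not_less by blast
        then obtain x s y where *: "x \<prec> t" "s \<prec> t" "y \<prec> t" "mem x R" "mem s R" "mem y R" "eq_color x s y t"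
          using R tH by blast
        have "x \<prec> s" using eq_color_less(1)[OF *(7)] .
        then have "x \<oplus> s \<prec> b \<oplus> b"
          using b[OF *(5)] by (intro A.add_less_le_mono) auto
        then have "code x s \<prec> code b b" by (rule code_less)
        moreover have "G t (code x s)" unfolding G_def E using * by blast
        ultimately show ?thesis by blast
      qed
      show "t = t'" if "G t i" "G t' i" for t t' i
      proof -
        obtain x s y where 1: "i = code x s" "s \<prec> t" "eq_color x s y t"
          using \<open>G t i\<close> unfolding G_def E by blast
        obtain x' s' y' where 2: "i = code x' s'" "s' \<prec> t'" "eq_color x' s' y' t'"
          using \<open>G t' i\<close> unfolding G_def E by blast
        \<comment> \<open>The pair coded by \<open>i\<close> and those ending in \<open>t\<close>
          and \<open>t'\<close> share a color. As \<open>s\<close> lies below both, neither of these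
          equals the coded pair, so two-boundedness identifies them.\<close>
        from 1 2 show ?thesis using eq_color_two_bounded not_less_self by fastforce
      qed
      show "\<exists>t. b \<prec> t \<and> mem t H" for b by (rule H)
    qed
  qed
  moreover have "x = y \<and> s = t"
    if mem: "mem x R" "mem s R" "mem y R" "mem t R" and eq: "eq_color x s y t" for x s y t
  proof -
    note eq' = eq_color_sym[OF eq]
    note less = eq_color_less[OF eq]
    \<comment> \<open>With different maxima, the larger one would have been rejected by the
      thinning.\<close>
    have "\<not> s \<prec> t" using R[of t] mem eq less less_trans' by blast
    moreover have "\<not> t \<prec> s" using R[of s] mem eq' less less_trans' by blast
    ultimately have "s = t" using less_linear' by blast
    moreover from this have "x = y" using no_eq eq mem R by blast
    ultimately show ?thesis by blast
  qed
  ultimately show ?thesis by blast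
qed

end

section \<open>The implication in models and its provability\<close>

context RCA0_model
begin

lemma SEM_imp_SRRT22:
  assumes SEM: "\<And>e S. sat e S SEM"
  shows "sat e S SRRT22"
proof -
  have "\<exists>R. (\<forall>b. \<exists>t. b \<prec> t \<and> mem t R) \<and>
    (\<forall>x s y t c. mem x R \<and> mem s R \<and> mem y R \<and> mem t R \<and> x \<prec> s \<and> y \<prec> t \<and>
      mem (code (code x s) c) F \<and> mem (code (code y t) c) F \<longrightarrow> x = y \<and> s = t)"
    if F: "sat e (case_nat F S) (coloring 0)" "sat e (case_nat F S) (two_bounded 0)"
      "sat e (case_nat F S) (rainbow_stable 0)" for F
  proof -
    interpret stable_coloring zero one add mul less mem F
      using F[unfolded sat_coloring sat_two_bounded sat_rainbow_stable old.nat.case]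
      by unfold_locales blast+
    obtain D T where D: "\<And>n. mem n D"
      and irr: "\<And>x. \<not> mem (code x x) T"
      and asym: "\<And>x y. x \<noteq> y \<Longrightarrow> mem (code x y) T \<longleftrightarrow> \<not> mem (code y x) T"
      and codes: "\<And>n. mem n T \<Longrightarrow> \<exists>x y. n = code x y"
      and stable: "\<And>x. (\<exists>b. \<forall>s. b \<prec> s \<longrightarrow> mem (code x s) T) \<or> (\<exists>b. \<forall>s. b \<prec> s \<longrightarrow> mem (code s x) T)"
      and cycle: "\<And>x y s. y \<prec> x \<Longrightarrow> eq_color x s y s \<Longrightarrow>
        (mem (code y x) T \<and> mem (code x s) T \<and> mem (code s y) T) \<or>
        (mem (code x y) T \<and> mem (code y s) T \<and> mem (code s x) T)"
      by (rule stable_tournament_exists) (rule that, assumption+)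
    let ?S = "case_nat T (case_nat D S)"
    have less_self: "b \<prec> b \<oplus> \<one>" for b by (simp add: less_Suc)
    have "sat e ?S (infinite_set 1)"
      unfolding sat_infinite_set One_nat_def old.nat.case using D less_self by blast
    moreover have "sat e ?S (tournament 1 0)"
      unfolding sat_tournament One_nat_def old.nat.case
      by (intro conjI allI impI) (use D codes irr asym in blast)+
    moreover have "sat e ?S (Defs.stable 1 0)"
      unfolding sat_stable One_nat_def old.nat.case using stable by blast
    moreover have "sat e ?S (infinite_set 1 \<^bold>\<and> tournament 1 0 \<^bold>\<and> Defs.stable 1 0 \<^bold>\<longrightarrow>
        SEx (infinite_set 0 \<^bold>\<and> subset_of 0 2 \<^bold>\<and> transitive_on 0 1))"
      using SEM[of e S] unfolding SEM_def sat.simps(7) by blast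
    ultimately obtain H where H: "sat e (case_nat H ?S) (infinite_set 0)"
      "sat e (case_nat H ?S) (transitive_on 0 1)"
      unfolding sat.simps by blast
    have trans: "mem (code x z) T"
      if "mem x H" "mem y H" "mem z H" "mem (code x y) T" "mem (code y z) T" for x y z
      using that H(2) unfolding sat_transitive_on One_nat_def old.nat.case by blast
    \<comment> \<open>Transitivity would close the cycle through \<open>y\<close>, \<open>x\<close>
      and \<open>s\<close> to a loop at one of its vertices.\<close>
    have no_eq_less: "\<not> y \<prec> x" if "mem x H" "mem y H" "mem s H" "eq_color x s y s" for x y s
      using that cycle[of y x s] trans irr by blast
    then have no_eq: "\<forall>x y s. mem x H \<and> mem y H \<and> mem s H \<and> eq_color x s y s \<longrightarrow> x = y"
      using eq_color_sym less_linear' by blast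
    have inf: "\<exists>t. b \<prec> t \<and> mem t H" for b
      using H(1) unfolding sat_infinite_set old.nat.case by blast
    from rainbow_exists[OF inf no_eq] obtain R where R: "\<forall>b. \<exists>t. b \<prec> t \<and> mem t R"
      "\<forall>x s y t. mem x R \<longrightarrow> mem s R \<longrightarrow> mem y R \<longrightarrow> mem t R \<longrightarrow> eq_color x s y t \<longrightarrow> x = y \<and> s = t"
      by blast
    show ?thesis
      by (rule exI[of _ R]) (use R in \<open>unfold eq_color_def, blast\<close>)
  qed
  then show ?thesis
    unfolding SRRT22_def sat.simps sat_infinite_set sat_rainbow One_nat_def old.nat.case by blast
qed

end

theorem corollary5p32:
  shows "RCA0 \<turnstile> SEM \<^bold>\<longrightarrow> SRRT22"
proof (rule ccontr)
  let ?p = "SEM \<^bold>\<longrightarrow> SRRT22"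
  assume "\<not> RCA0 \<turnstile> ?p"
  then have con: "consistent (insert (\<^bold>\<not> ?p) RCA0)"
    by (simp only: consistent_insert_Neg not_False_eq_True)
  have "sentence (\<^bold>\<not> ?p)"
    by (simp add: sentence_def SEM_def SRRT22_def infinite_set_def tournament_def stable_def rel_def
        pair_def subset_of_def transitive_on_def coloring_def val_def two_bounded_def
        rainbow_stable_def same_val_def rainbow_def)
  then have "\<And>q. q \<in> insert (\<^bold>\<not> ?p) RCA0 \<Longrightarrow> sentence q"
    using RCA0_sentence by blast
  from model_existence[OF con this] obtain zero one :: nat and add mul less
    and mem :: "nat \<Rightarrow> nat \<Rightarrow> bool" where
    M: "\<And>q e S. q \<in> insert (\<^bold>\<not> ?p) RCA0 \<Longrightarrow> interp.sat zero one add mul less mem e S q"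
    by blast
  interpret RCA0_model zero one add mul less mem
    by unfold_locales (rule M, simp)
  have neg: "sat e S SEM \<and> \<not> sat e S SRRT22" for e S
    using M[of "\<^bold>\<not> ?p" e S] by simp
  then show False using SEM_imp_SRRT22 by blast
qed

end
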